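(* Let $\alpha,b,x_1,\dots,x_n,a_1,\dots,a_n$ be complex parameters such that no denominator in the identity below vanishes. Let $f(y)$ be a complex function of one variable (defined at all points where it is evaluated below). Assume that either (i) $f$ is such that both sides of the identity are analytic in $a_1,\dots,a_n$ and the series converges absolutely for each $a_r$ in a disk around the origin, and each $a_r$ lies in this disk; or (ii) $a_r=q^{N_r}$ with $N_r$ a positive integer for $r=1,\dots,n$ (so that the series terminates). Then $$\begin{aligned} & f(\alpha a_{1}\cdots a_{n}q^{1-n})\frac{(\alpha q)_{\infty}}{(\alpha a_{1}\cdots a_{n}q^{1-n})_{\infty}}\prod_{r=1}^{n}\frac{(\alpha a_{r}bx_{r}/q)_{\infty}}{(\alpha bx_{r})_{\infty}}\\ &=\sum_{k_1,\dots,k_n\ge0}\ \prod_{1\leq r<s\leq n}\frac{1-q^{k_{r}-k_{s}}x_{r}/x_{s}}{1-x_{r}/x_{s}}\prod_{r,s=1}^{n}\frac{(qx_{r}/(x_{s}a_{s}))_{k_{r}}}{(qx_{r}/x_{s})_{k_{r}}}\\ &\quad\times\frac{(1-\alpha q^{2|\boldsymbol{k}|})(\alpha)_{|\boldsymbol{k}|}}{(1-\alpha)(\alpha a_{1}\cdots a_{n}q^{1-n})_{|\boldsymbol{k}|}}(a_{1}\cdots a_{n})^{|\boldsymbol{k}|}q^{\sum_{r=1}^{n}(r-1)k_{r}-n|\boldsymbol{k}|}\\ &\quad\times\sum_{\substack{0\leq m_{r}\leq k_{r}\\ r=1,\dots,n}}\ \prod_{1\leq r<s\leq n}\frac{1-q^{m_{r}-m_{s}}x_{r}/x_{s}}{1-x_{r}/x_{s}}\prod_{r,s=1}^{n}\frac{(q^{-k_{s}}x_{r}/x_{s})_{m_{r}}}{(qx_{r}/x_{s})_{m_{r}}}\cdot\frac{(\alpha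 q^{|\boldsymbol{k}|})_{|\boldsymbol{m}|}}{\prod_{r=1}^{n}(\alpha bx_{r})_{m_{r}}}q^{\sum_{r=1}^{n}rm_{r}}f(\alpha q^{1+|\boldsymbol{m}|}). \end{aligned}$$
   Context: $q$ is a complex number with $0<|q|<1$ and $n\ge1$ is an integer. $(z)_\infty=\prod_{i\ge0}(1-zq^i)$ and $(z)_k=(z)_\infty/(zq^k)_\infty=\prod_{i=0}^{k-1}(1-zq^i)$. Bold letters denote multi-indices of nonnegative integers, $\boldsymbol k=(k_1,\dots,k_n)$, with $|\boldsymbol k|=k_1+\cdots+k_n$. If some $a_s=0$, the expression $\prod_{r,s}(qx_r/(x_sa_s))_{k_r}(a_1\cdots a_n)^{|\boldsymbol k|}$, which is polynomial in the $a_s$, is understood by continuity. *)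

theory Defs
  imports "HOL-Analysis.Analysis"
begin

definition qpoch_inf :: "complex \<Rightarrow> complex \<Rightarrow> complex" where
  "qpoch_inf q z = (\<Prod>i. 1 - z * q ^ i)"

definition qpoch :: "complex \<Rightarrow> complex \<Rightarrow> nat \<Rightarrow> complex" where
  "qpoch q z k = (\<Prod>i<k. 1 - z * q ^ i)"

text \<open>
  Vectors with entries numbered 1, ..., n are functions on \<^typ>\<open>nat\<close>; only the values on
  \<open>{1..n}\<close> matter. Multi-indices that are summed over are extensional, so that each is
  counted exactly once.
\<close>

definition multi_indices :: "nat \<Rightarrow> (nat \<Rightarrow> nat) set" where
  "multi_indices n = ({1..n} \<rightarrow>\<^sub>E UNIV)"

definition multi_indices_le :: "nat \<Rightarrow> (nat \<Rightarrow> nat) \<Rightarrow> (nat \<Rightarrow> nat) set" where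
  "multi_indices_le n k = (\<Pi>\<^sub>E r\<in>{1..n}. {0..k r})"

definition msize :: "nat \<Rightarrow> (nat \<Rightarrow> nat) \<Rightarrow> nat" where
  "msize n k = (\<Sum>r=1..n. k r)"

definition polydisc :: "nat \<Rightarrow> (nat \<Rightarrow> real) \<Rightarrow> (nat \<Rightarrow> complex) set" where
  "polydisc n \<rho> = {a. \<forall>r\<in>{1..n}. norm (a r) < \<rho> r}"

text \<open>
  Joint analyticity in the variables with index in \<open>{1..n}\<close>: near every point of the set the
  function is the sum of an (unconditionally, hence absolutely) convergent n-fold power series.
\<close>

definition multi_analytic_on ::
    "nat \<Rightarrow> ((nat \<Rightarrow> complex) \<Rightarrow> complex) \<Rightarrow> (nat \<Rightarrow> complex) set \<Rightarrow> bool" where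
  "multi_analytic_on n F D \<longleftrightarrow>
     (\<forall>c\<in>D. \<exists>C. \<exists>\<epsilon>>0. \<forall>a. (\<forall>r\<in>{1..n}. norm (a r - c r) < \<epsilon>) \<longrightarrow>
        ((\<lambda>j. C j * (\<Prod>r=1..n. (a r - c r) ^ j r)) has_sum F a) (multi_indices n))"

definition vandermonde_quot :: "complex \<Rightarrow> nat \<Rightarrow> (nat \<Rightarrow> complex) \<Rightarrow> (nat \<Rightarrow> nat) \<Rightarrow> complex" where
  "vandermonde_quot q n x k =
     (\<Prod>(r, s)\<in>{(r, s). 1 \<le> r \<and> r < s \<and> s \<le> n}.
        (1 - q powi (int (k r) - int (k s)) * (x r / x s)) / (1 - x r / x s))"

definition numer_raw ::
    "complex \<Rightarrow> nat \<Rightarrow> (nat \<Rightarrow> complex) \<Rightarrow> (nat \<Rightarrow> nat) \<Rightarrow> (nat \<Rightarrow> complex) \<Rightarrow> complex" where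
  "numer_raw q n x k a =
     (\<Prod>r=1..n. \<Prod>s=1..n. qpoch q (q * x r / (x s * a s)) (k r)) * (\<Prod>r=1..n. a r) ^ msize n k"

text \<open>If some entry of \<open>a\<close> is 0, the expression is understood by continuity.\<close>

definition numer ::
    "complex \<Rightarrow> nat \<Rightarrow> (nat \<Rightarrow> complex) \<Rightarrow> (nat \<Rightarrow> nat) \<Rightarrow> (nat \<Rightarrow> complex) \<Rightarrow> complex" where
  "numer q n x k a =
     (if \<forall>s\<in>{1..n}. a s \<noteq> 0 then numer_raw q n x k a
      else Lim (at a within {c. \<forall>s\<in>{1..n}. c s \<noteq> 0}) (numer_raw q n x k))"

definition lhs ::
    "complex \<Rightarrow> nat \<Rightarrow> (complex \<Rightarrow> complex) \<Rightarrow> complex \<Rightarrow> complex \<Rightarrow> (nat \<Rightarrow> complex) \<Rightarrow>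
     (nat \<Rightarrow> complex) \<Rightarrow> complex" where
  "lhs q n f \<alpha> b x a =
     f (\<alpha> * (\<Prod>r=1..n. a r) * q powi (1 - int n)) *
     (qpoch_inf q (\<alpha> * q) / qpoch_inf q (\<alpha> * (\<Prod>r=1..n. a r) * q powi (1 - int n))) *
     (\<Prod>r=1..n. qpoch_inf q (\<alpha> * a r * b * x r / q) / qpoch_inf q (\<alpha> * b * x r))"

definition inner_sum ::
    "complex \<Rightarrow> nat \<Rightarrow> (complex \<Rightarrow> complex) \<Rightarrow> complex \<Rightarrow> complex \<Rightarrow> (nat \<Rightarrow> complex) \<Rightarrow>
     (nat \<Rightarrow> nat) \<Rightarrow> complex" where
  "inner_sum q n f \<alpha> b x k =
     (\<Sum>m\<in>multi_indices_le n k.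
        vandermonde_quot q n x m *
        (\<Prod>r=1..n. \<Prod>s=1..n.
           qpoch q (q powi (- int (k s)) * (x r / x s)) (m r) / qpoch q (q * x r / x s) (m r)) *
        (qpoch q (\<alpha> * q ^ msize n k) (msize n m) / (\<Prod>r=1..n. qpoch q (\<alpha> * b * x r) (m r))) *
        q ^ (\<Sum>r=1..n. r * m r) *
        f (\<alpha> * q ^ (1 + msize n m)))"

text \<open>
  The summand of the outer series. The factor \<^const>\<open>numer\<close> collects the numerators of the
  double product over r, s together with the power of the product of the entries of \<open>a\<close>.
\<close>

definition outer_term ::
    "complex \<Rightarrow> nat \<Rightarrow> (complex \<Rightarrow> complex) \<Rightarrow> complex \<Rightarrow> complex \<Rightarrow> (nat \<Rightarrow> complex) \<Rightarrow>
     (nat \<Rightarrow> complex) \<Rightarrow> (nat \<Rightarrow> nat) \<Rightarrow> complex" where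
  "outer_term q n f \<alpha> b x a k =
     vandermonde_quot q n x k *
     (numer q n x k a / (\<Prod>r=1..n. \<Prod>s=1..n. qpoch q (q * x r / x s) (k r))) *
     ((1 - \<alpha> * q ^ (2 * msize n k)) * qpoch q \<alpha> (msize n k) /
       ((1 - \<alpha>) * qpoch q (\<alpha> * (\<Prod>r=1..n. a r) * q powi (1 - int n)) (msize n k))) *
     q powi ((\<Sum>r=1..n. (int r - 1) * int (k r)) - int n * int (msize n k)) *
     inner_sum q n f \<alpha> b x k"

definition rhs ::
    "complex \<Rightarrow> nat \<Rightarrow> (complex \<Rightarrow> complex) \<Rightarrow> complex \<Rightarrow> complex \<Rightarrow> (nat \<Rightarrow> complex) \<Rightarrow>
     (nat \<Rightarrow> complex) \<Rightarrow> complex" where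
  "rhs q n f \<alpha> b x a = (\<Sum>\<^sub>\<infinity>k\<in>multi_indices n. outer_term q n f \<alpha> b x a k)"

definition no_denominator_vanishes ::
    "complex \<Rightarrow> nat \<Rightarrow> complex \<Rightarrow> complex \<Rightarrow> (nat \<Rightarrow> complex) \<Rightarrow> (nat \<Rightarrow> complex) \<Rightarrow> bool" where
  "no_denominator_vanishes q n \<alpha> b x a \<longleftrightarrow>
     \<alpha> \<noteq> 1 \<and>
     (\<forall>r\<in>{1..n}. x r \<noteq> 0) \<and>
     (\<forall>r\<in>{1..n}. \<forall>s\<in>{1..n}. r < s \<longrightarrow> 1 - x r / x s \<noteq> 0) \<and>
     (\<forall>r\<in>{1..n}. \<forall>s\<in>{1..n}. \<forall>k. qpoch q (q * x r / x s) k \<noteq> 0) \<and>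
     qpoch_inf q (\<alpha> * (\<Prod>r=1..n. a r) * q powi (1 - int n)) \<noteq> 0 \<and>
     (\<forall>k. qpoch q (\<alpha> * (\<Prod>r=1..n. a r) * q powi (1 - int n)) k \<noteq> 0) \<and>
     (\<forall>r\<in>{1..n}. qpoch_inf q (\<alpha> * b * x r) \<noteq> 0) \<and>
     (\<forall>r\<in>{1..n}. \<forall>k. qpoch q (\<alpha> * b * x r) k \<noteq> 0)"

text \<open>The extension by continuity in \<^const>\<open>numer\<close> is the expected polynomial in \<open>a\<close>.\<close>

lemma numer_raw_eq_poly:
  assumes "\<forall>s\<in>{1..n}. a s \<noteq> 0"
  shows "numer_raw q n x k a = (\<Prod>r=1..n. \<Prod>s=1..n. \<Prod>i<k r. a s - q ^ Suc i * x r / x s)"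
proof -
  have "(\<Prod>r=1..n. a r) ^ msize n k = (\<Prod>r=1..n. (\<Prod>s=1..n. a s) ^ k r)"
    by (simp add: msize_def power_sum)
  also have "\<dots> = (\<Prod>r=1..n. \<Prod>s=1..n. \<Prod>i<k r. a s)"
    by (simp add: prod_power_distrib)
  finally have "numer_raw q n x k a =
      (\<Prod>r=1..n. \<Prod>s=1..n. \<Prod>i<k r. (1 - q * x r / (x s * a s) * q ^ i) * a s)"
    by (simp add: numer_raw_def qpoch_def prod.distrib)
  also have "\<dots> = (\<Prod>r=1..n. \<Prod>s=1..n. \<Prod>i<k r. a s - q ^ Suc i * x r / x s)"
    using assms by (intro prod.cong refl) (auto simp: field_simps)
  finally show ?thesis .
qed

lemma numer_eq_poly:
  "numer q n x k a = (\<Prod>r=1..n. \<Prod>s=1..n. \<Prod>i<k r. a s - q ^ Suc i * x r / x s)"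
proof (cases "\<forall>s\<in>{1..n}. a s \<noteq> 0")
  case True
  then have "numer q n x k a = numer_raw q n x k a"
    unfolding numer_def by (rule if_P)
  with numer_raw_eq_poly[OF True] show ?thesis by simp
next
  case False
  define S where "S = {c :: nat \<Rightarrow> complex. \<forall>s\<in>{1..n}. c s \<noteq> 0}"
  define P where "P = (\<lambda>c. \<Prod>r=1..n. \<Prod>s=1..n. \<Prod>i<k r. c s - q ^ Suc i * x r / x s)"
  have "continuous_on UNIV P"
    unfolding P_def by (intro continuous_intros continuous_on_product_coordinates)
  then have "(P \<longlongrightarrow> P a) (at a within S)"
    by (metis UNIV_I continuous_on_def subset_UNIV tendsto_within_subset)
  moreover have "\<forall>\<^sub>F c in at a within S. P c = numer_raw q n x k c"
    unfolding eventually_at_filter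
    by (rule always_eventually) (auto simp: S_def P_def numer_raw_eq_poly)
  ultimately have lim: "(numer_raw q n x k \<longlongrightarrow> P a) (at a within S)"
    by (rule Lim_transform_eventually)
  have "a islimpt S"
    unfolding islimpt_def
  proof (intro allI impI)
    fix T :: "(nat \<Rightarrow> complex) set"
    assume T: "a \<in> T" "open T"
    define g where "g = (\<lambda>(t::complex) s. if a s = 0 then t else a s)"
    have "continuous_on UNIV g"
      unfolding g_def
    proof (rule continuous_on_coordinatewise_then_product)
      show "continuous_on UNIV (\<lambda>t. if a s = 0 then t else a s)" for s
        by (cases "a s = 0") auto
    qed
    then have "open (g -` T)"
      using T(2) by (simp add: open_vimage)
    moreover have "g 0 = a" by (auto simp: g_def)
    ultimately obtain e where e: "e > 0" "ball 0 e \<subseteq> g -` T"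
      using T(1) by (metis openE vimageI)
    define t :: complex where "t = of_real (e / 2)"
    have t: "t \<noteq> 0" "t \<in> ball 0 e" using e(1) by (auto simp: t_def)
    have "g t \<in> T" using t e by auto
    moreover have "g t \<in> S" using t by (auto simp: g_def S_def)
    moreover have "g t \<noteq> a" using False \<open>g t \<in> S\<close> by (auto simp: S_def)
    ultimately show "\<exists>y\<in>S. y \<in> T \<and> y \<noteq> a" by blast
  qed
  then have "at a within S \<noteq> bot"
    by (simp add: trivial_limit_within)
  then have "Lim (at a within S) (numer_raw q n x k) = P a"
    using lim by (rule tendsto_Lim)
  moreover have "numer q n x k a = Lim (at a within S) (numer_raw q n x k)"
    using False unfolding numer_def S_def by (subst if_not_P) auto
  ultimately show ?thesis by (simp add: P_def)
qed

end

theory Submission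
  imports Defs "HOL-Complex_Analysis.Complex_Analysis"
begin

text \<open>
  In the terminating case \<open>a\<^sub>r = q\<^bsup>N\<^sub>r\<^esup>\<close> only multi-indices \<open>k \<le> K = N - 1\<close> contribute. After
  exchanging the two sums, the coefficient of the term with inner index \<open>m\<close> is a sum over
  \<open>k = m + l\<close>; up to factors independent of \<open>l\<close>, its dependence on \<open>l\<close> is a Milne summand
  with parameters \<open>x\<^sub>r q\<^bsup>m\<^sub>r\<^esup>\<close> times a function of \<open>|l|\<close>. Milne's fundamental \<open>A\<^sub>n\<close> summation collapses
  it to a one-variable very-well-poised sum, which telescopes to 0 unless \<open>m = K\<close>; the term
  \<open>m = K\<close> is the left-hand side. In the analytic case both sides agree at all points
  \<open>(q\<^bsup>N\<^sub>1\<^esup>, \<dots>, q\<^bsup>N\<^sub>n\<^esup>)\<close> with large \<open>N\<^sub>r\<close>, and these accumulate at 0 in each variable, so the identity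
  theorem in one variable at a time finishes the proof.
\<close>

subsection \<open>Partial fractions and \<open>q\<close>-shifted factorials\<close>

text \<open>Partial fractions in \<open>t\<close> with simple poles at the \<open>z r\<close>.
  Written with \<open>t / (z r - t)\<close>, the constant term is the value 1 at
  \<open>t = 0\<close> (if no \<open>z r\<close> is 0). The induction uses the expansion for
  \<open>I\<close> both at \<open>t\<close> and at the new point \<open>z u\<close>.\<close>

lemma prod_linear_quot_partial_fractions:
  fixes z c :: "'i \<Rightarrow> 'a :: field"
  assumes "finite I" "inj_on z I" "t \<notin> z ` I"
  shows "(\<Prod>s\<in>I. (z s - c s * t) / (z s - t)) =
    1 + (\<Sum>r\<in>I. (1 - c r) * (t / (z r - t)) * (\<Prod>s\<in>I - {r}. (z s - c s * z r) / (z s - z r)))"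
  using assms
proof (induction I arbitrary: t rule: finite_induct)
  case (insert u I)
  define A where "A r = (1 - c r) * (\<Prod>s\<in>I - {r}. (z s - c s * z r) / (z s - z r))" for r
  have ne: "z u \<noteq> t" "z u \<notin> z ` I" "t \<notin> z ` I" "inj_on z I"
    using insert.prems insert.hyps by (auto simp: inj_on_def)
  have IH: "(\<Prod>s\<in>I. (z s - c s * t) / (z s - t)) = 1 + (\<Sum>r\<in>I. t / (z r - t) * A r)"
    if "t \<notin> z ` I" for t
    unfolding insert.IH[OF ne(4) that] A_def by (simp add: mult_ac)
  have "(\<Sum>r\<in>insert u I. (1 - c r) * (t / (z r - t)) * (\<Prod>s\<in>insert u I - {r}. (z s - c s * z r) / (z s - z r)))
     = (1 - c u) * (t / (z u - t)) * (1 + (\<Sum>r\<in>I. z u / (z r - z u) * A r))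
      + (\<Sum>r\<in>I. t / (z r - t) * ((z u - c u * z r) / (z u - z r)) * A r)"
  proof -
    have "(1 - c r) * (t / (z r - t)) * (\<Prod>s\<in>insert u I - {r}. (z s - c s * z r) / (z s - z r))
        = t / (z r - t) * ((z u - c u * z r) / (z u - z r)) * A r" if "r \<in> I" for r
    proof -
      have "insert u I - {r} = insert u (I - {r})" using that insert.hyps by auto
      then show ?thesis using insert.hyps by (simp add: A_def mult_ac)
    qed
    then show ?thesis using insert.hyps IH[OF ne(2)] by simp
  qed
  also have "\<dots> = (1 - c u) * (t / (z u - t)) + (\<Sum>r\<in>I. (t / (z r - t)) * ((z u - c u * t) / (z u - t)) * A r)"
  proof -
    \<comment> \<open>Both contributions to \<open>A r\<close>, the direct one and the one from
      expanding the \<open>u\<close> term at \<open>z u\<close>, are merged; the denominator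
      \<open>z u - z r\<close> cancels.\<close>
    have "t / (z r - t) * ((z u - c u * z r) / (z u - z r)) * A r
       + (1 - c u) * (t / (z u - t)) * (z u / (z r - z u) * A r)
       = t / (z r - t) * ((z u - c u * t) / (z u - t)) * A r" if "r \<in> I" for r
    proof -
      have d: "z r - t \<noteq> 0" "z u - t \<noteq> 0" "z u - z r \<noteq> 0" "z r - z u \<noteq> 0" using ne that by (force simp: image_iff)+
      have "z u / (z r - z u) = - z u / (z u - z r)" using d by (simp add: field_simps)
      moreover have "t / (z r - t) * ((z u - c u * z r) / (z u - z r))
         - (1 - c u) * (t / (z u - t)) * (z u / (z u - z r))
         = t / (z r - t) * ((z u - c u * t) / (z u - t))"
        using d(1-3) by (simp add: divide_simps) (simp add: algebra_simps)
      ultimately show ?thesis by algebra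
    qed
    from sum.cong[OF refl this, of I "\<lambda>x. x"] show ?thesis
      by (simp add: sum.distrib sum_distrib_left distrib_left mult.assoc add.commute)
  qed
  also have "1 + \<dots> = ((z u - c u * t) / (z u - t)) * (1 + (\<Sum>r\<in>I. t / (z r - t) * A r))"
  proof -
    define B where "B = (z u - c u * t) / (z u - t)"
    have "1 + (1 - c u) * (t / (z u - t)) = B"
      unfolding B_def using ne(1) by (simp add: divide_simps) (simp add: algebra_simps)
    then show ?thesis
      unfolding B_def[symmetric] by (simp add: distrib_left sum_distrib_left add.assoc[symmetric] mult_ac)
  qed
  finally show ?case using insert.hyps IH[OF ne(3)] by simp
qed simp

text \<open>Heuristically the limit of the preceding expansion as \<open>t\<close> tends to
  infinity, where each \<open>t / (z r - t)\<close> becomes -1. The proof stays algebraic, so any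
  field is allowed: the preceding lemma at \<open>t = z u\<close> expands the product of the new
  index.\<close>

lemma sum_prod_linear_quot:
  fixes z c :: "'i \<Rightarrow> 'a :: field"
  assumes "finite I" "inj_on z I"
  shows "(\<Sum>r\<in>I. (1 - c r) * (\<Prod>s\<in>I - {r}. (z s - c s * z r) / (z s - z r))) = 1 - (\<Prod>r\<in>I. c r)"
  using assms
proof (induction I rule: finite_induct)
  case (insert u I)
  define A where "A r = (1 - c r) * (\<Prod>s\<in>I - {r}. (z s - c s * z r) / (z s - z r))" for r
  have ne: "z u \<notin> z ` I" "inj_on z I"
    using insert.prems insert.hyps by (auto simp: inj_on_def)
  have H: "(\<Prod>s\<in>I. (z s - c s * z u) / (z s - z u)) = 1 - (\<Sum>r\<in>I. z u / (z u - z r) * A r)"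
  proof -
    have "t / (z r - t) = - (t / (t - z r))" for t r
      by (metis minus_diff_eq minus_divide_right)
    then show ?thesis
      unfolding prod_linear_quot_partial_fractions[OF insert.hyps(1) ne(2,1)] A_def
      by (simp add: mult_ac sum_negf)
  qed
  have "(1 - c r) * (\<Prod>s\<in>insert u I - {r}. (z s - c s * z r) / (z s - z r))
      = c u * A r + (1 - c u) * (z u / (z u - z r) * A r)" if "r \<in> I" for r
  proof -
    have "insert u I - {r} = insert u (I - {r})" using that insert.hyps by auto
    then have "(1 - c r) * (\<Prod>s\<in>insert u I - {r}. (z s - c s * z r) / (z s - z r)) = ((z u - c u * z r) / (z u - z r)) * A r"
      using insert.hyps by (simp add: A_def mult_ac)
    also have "(z u - c u * z r) / (z u - z r) = c u + (1 - c u) * (z u / (z u - z r))"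
    proof -
      have "z u - z r \<noteq> 0" using ne that by (force simp: image_iff)
      then show ?thesis by (simp add: divide_simps) (simp add: algebra_simps)
    qed
    finally show ?thesis by (simp add: algebra_simps)
  qed
  from sum.cong[OF refl this, of I "\<lambda>r. r"]
  have "(\<Sum>r\<in>insert u I. (1 - c r) * (\<Prod>s\<in>insert u I - {r}. (z s - c s * z r) / (z s - z r)))
     = (1 - c u) * (1 - (\<Sum>r\<in>I. z u / (z u - z r) * A r))
       + (c u * (\<Sum>r\<in>I. A r) + (1 - c u) * (\<Sum>r\<in>I. z u / (z u - z r) * A r))"
    using insert.hyps H by (simp only: sum.insert sum.distrib sum_distrib_left) simp
  also have "\<dots> = c u * (\<Sum>r\<in>I. A r) + (1 - c u)"
    by (simp only: right_diff_distrib mult_1_right) simp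
  also have "(\<Sum>r\<in>I. A r) = 1 - (\<Prod>r\<in>I. c r)"
    using insert.IH ne by (simp add: A_def)
  finally show ?case using insert.hyps by (simp add: algebra_simps)
qed simp

section \<open>Elementary rules for finite q-shifted factorials\<close>

lemma qpoch_0 [simp]: "qpoch q z 0 = 1"
  by (simp add: qpoch_def)

lemma qpoch_Suc: "qpoch q z (Suc k) = qpoch q z k * (1 - z * q ^ k)"
  by (simp add: qpoch_def)

lemma qpoch_add: "qpoch q z (j + k) = qpoch q z j * qpoch q (z * q ^ j) k"
proof (induction k)
  case (Suc k)
  then show ?case by (simp add: qpoch_Suc power_add mult_ac)
qed simp

lemma qpoch_eq_0_iff: "qpoch q z k = 0 \<longleftrightarrow> (\<exists>i<k. z * q ^ i = 1)"
  by (auto simp: qpoch_def)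

text \<open>
  The partial sums up to \<open>J - 1\<close> have the closed form
  \<open>- t\<^sub>J (1 - q\<^sup>J) (1 - A q\<^bsup>L+J\<^esup>) / (1 - q\<^sup>L)\<close>, where \<open>t\<^sub>J\<close> is the summand without its factor
  \<open>1 - A q\<^bsup>2J\<^esup>\<close>. That factor is not normalised by \<open>1 - A\<close>, so that \<open>A = 1\<close> is allowed.
\<close>

lemma vwp_sum_eq_0:
  assumes "L > 0" "q \<noteq> 0" "\<And>j. j > 0 \<Longrightarrow> q ^ j \<noteq> 1" "\<And>j. qpoch q (A * q ^ Suc L) j \<noteq> 0"
  shows "(\<Sum>j\<le>L. qpoch q (1 / q ^ L) j / qpoch q q j *
      ((1 - A * q ^ (2 * j)) * qpoch q A j / qpoch q (A * q ^ Suc L) j) * q ^ (L * j)) = 0"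
proof -
  define t where "t j = qpoch q (1 / q ^ L) j / qpoch q q j * (qpoch q A j / qpoch q (A * q ^ Suc L) j) * q ^ (L * j)" for j
  have qq: "1 - q ^ Suc j \<noteq> 0" for j using assms(3)[of "Suc j"] by auto
  have qA: "1 - A * q ^ (Suc L + j) \<noteq> 0" for j
    using assms(4)[of "Suc j"] by (simp add: qpoch_Suc power_add mult_ac)
  have qq0: "qpoch q q j \<noteq> 0" for j using qq by (auto simp: qpoch_eq_0_iff)
  have tS: "t (Suc j) * ((1 - q ^ Suc j) * (1 - A * q ^ (Suc L + j)))
        = t j * ((1 - q ^ j / q ^ L) * (1 - A * q ^ j) * q ^ L)" for j
  proof -
    have "t (Suc j) = t j * ((1 - q ^ j / q ^ L) / (1 - q ^ Suc j) * ((1 - A * q ^ j) / (1 - A * q ^ (Suc L + j))) * q ^ L)"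
      by (simp add: t_def qpoch_Suc power_add mult_ac)
    then show ?thesis using qq[of j] qA[of j] by (simp del: power_Suc)
  qed
  have "(1 - q ^ L) * (\<Sum>j<J. (1 - A * q ^ (2 * j)) * t j) =
      - (t J * (1 - q ^ J) * (1 - A * q ^ (L + J)))" for J
  proof (induction J)
    case (Suc J)
    have "(1 - q ^ L) * (\<Sum>j<Suc J. (1 - A * q ^ (2 * j)) * t j) =
       t J * ((1 - q ^ L) * (1 - A * q ^ (2 * J)) - (1 - q ^ J) * (1 - A * q ^ (L + J)))"
      using Suc by (simp add: algebra_simps)
    also have "(1 - q ^ L) * (1 - A * q ^ (2 * J)) - (1 - q ^ J) * (1 - A * q ^ (L + J))
        = - ((1 - q ^ J / q ^ L) * (1 - A * q ^ J) * q ^ L)"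
      unfolding mult_2 power_add using assms(2) by (simp add: field_simps)
    finally show ?case using tS[of J] by (simp add: mult_ac)
  qed simp
  \<comment> \<open>At \<open>J = L + 1\<close> the closed form is, up to sign, the left side of
    \<open>tS\<close> at \<open>L\<close>, and the right side there has the factor
    \<open>1 - q ^ L / q ^ L = 0\<close>.\<close>
  from this[of "Suc L"] have "(1 - q ^ L) * (\<Sum>j\<le>L. (1 - A * q ^ (2 * j)) * t j) = 0"
    using assms(2) tS[of L] by (simp add: lessThan_Suc_atMost)
  moreover have "1 - q ^ L \<noteq> 0" using assms(1,3) by auto
  ultimately show ?thesis by (simp add: t_def mult_ac)
qed

subsection \<open>Milne's fundamental summation\<close>

definition ordered_pairs :: "nat \<Rightarrow> (nat \<times> nat) set" where
  "ordered_pairs n = {(r, s). 1 \<le> r \<and> r < s \<and> s \<le> n}"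

lemma finite_ordered_pairs [simp]: "finite (ordered_pairs n)"
  by (rule finite_subset[of _ "{1..n} \<times> {1..n}"]) (auto simp: ordered_pairs_def)

text \<open>Each \<open>s\<close> is the second entry of \<open>s - 1\<close> pairs. This is where
  the powers of \<open>q\<close> with exponent \<open>(r - 1) * k r\<close> in the series come
  from.\<close>

lemma prod_ordered_pairs_by_snd:
  "(\<Prod>(r, s)\<in>ordered_pairs n. h s) = (\<Prod>s=1..n. h s ^ (s - 1))" for h :: "nat \<Rightarrow> 'a :: comm_monoid_mult"
proof -
  have "ordered_pairs n = (\<lambda>(s, r). (r, s)) ` Sigma {1..n} (\<lambda>s. {1..<s})"
    by (force simp: ordered_pairs_def image_iff)
  moreover have "inj_on (\<lambda>(s, r). (r, s)) (Sigma {1..n} (\<lambda>s. {1..<s}))"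
    by (auto simp: inj_on_def)
  ultimately have "(\<Prod>(r, s)\<in>ordered_pairs n. h s) = (\<Prod>(s, r)\<in>Sigma {1..n} (\<lambda>s. {1..<s}). h s)"
    by (simp add: prod.reindex o_def case_prod_unfold)
  also have "\<dots> = (\<Prod>s=1..n. h s ^ (s - 1))"
    by (simp add: prod.Sigma[symmetric])
  finally show ?thesis .
qed

text \<open>Isolates the factors that change when only the entry \<open>u\<close> of a multi-index
  changes. Symmetry of \<open>h\<close> is required because \<open>u\<close> is the larger entry of
  some pairs and the smaller entry of others.\<close>

lemma prod_ordered_pairs_split:
  fixes h :: "nat \<Rightarrow> nat \<Rightarrow> 'a :: comm_monoid_mult"
  assumes u: "u \<in> {1..n}" and sym: "\<And>r s. h r s = h s r"
  shows "(\<Prod>(r, s)\<in>ordered_pairs n. h r s) =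
    (\<Prod>(r, s)\<in>{(r, s)\<in>ordered_pairs n. r \<noteq> u \<and> s \<noteq> u}. h r s) * (\<Prod>s\<in>{1..n} - {u}. h u s)"
proof -
  define g where "g s = (if s < u then (s, u) else (u, s))" for s
  define P where "P = {(r, s)\<in>ordered_pairs n. r \<noteq> u \<and> s \<noteq> u}"
  have fP: "finite P" by (rule finite_subset[of _ "ordered_pairs n"]) (auto simp: P_def)
  have "ordered_pairs n = P \<union> g ` ({1..n} - {u})"
    using u by (force simp: P_def g_def ordered_pairs_def image_iff)
  moreover have "P \<inter> g ` ({1..n} - {u}) = {}"
    by (auto simp: P_def g_def)
  moreover have "inj_on g ({1..n} - {u})"
    by (auto simp: inj_on_def g_def split: if_splits)
  moreover have "(case g s of (r, s) \<Rightarrow> h r s) = h u s" for s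
    using sym by (auto simp: g_def)
  ultimately show ?thesis
    unfolding P_def[symmetric] using fP by (simp add: prod.union_disjoint prod.reindex)
qed

text \<open>The quotient of the Vandermonde determinants at the points \<open>x r * q ^ k r\<close>
  and at the points \<open>x r\<close>. Unlike the factors of \<open>vandermonde_quot\<close>, its
  factors are symmetric in the two indices and free of negative powers of \<open>q\<close>.\<close>

definition vandermonde_ratio :: "complex \<Rightarrow> nat \<Rightarrow> (nat \<Rightarrow> complex) \<Rightarrow> (nat \<Rightarrow> nat) \<Rightarrow> complex" where
  "vandermonde_ratio q n x k =
     (\<Prod>(r, s)\<in>ordered_pairs n. (x s * q ^ k s - x r * q ^ k r) / (x s - x r))"

text \<open>The summand of Milne's \<open>A_n\<close> series. With \<open>c s\<close> a nonpositive
  power of \<open>q\<close> it occurs both in the outer and in the inner sum of the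
  identity.\<close>

definition milne_term ::
    "complex \<Rightarrow> nat \<Rightarrow> (nat \<Rightarrow> complex) \<Rightarrow> (nat \<Rightarrow> complex) \<Rightarrow> (nat \<Rightarrow> nat) \<Rightarrow> complex" where
  "milne_term q n x c k = vandermonde_ratio q n x k *
     (\<Prod>r=1..n. \<Prod>s=1..n. qpoch q (c s * x r / x s) (k r) / qpoch q (q * x r / x s) (k r))"

text \<open>The form of the nonvanishing conditions that survives replacing each \<open>x r\<close>
  by \<open>x r * q ^ m r\<close>, as the Bailey inversion needs.\<close>

definition q_generic :: "complex \<Rightarrow> nat \<Rightarrow> (nat \<Rightarrow> complex) \<Rightarrow> bool" where
  "q_generic q n x \<longleftrightarrow> q \<noteq> 0 \<and> (\<forall>j>0. q ^ j \<noteq> 1) \<and> (\<forall>r\<in>{1..n}. x r \<noteq> 0) \<and>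
     (\<forall>r\<in>{1..n}. \<forall>s\<in>{1..n}. r \<noteq> s \<longrightarrow> (\<forall>i j. x r * q ^ i \<noteq> x s * q ^ j))"

lemma q_genericD:
  assumes "q_generic q n x"
  shows "q \<noteq> 0" "j > 0 \<Longrightarrow> q ^ j \<noteq> 1" "r \<in> {1..n} \<Longrightarrow> x r \<noteq> 0"
    "r \<in> {1..n} \<Longrightarrow> s \<in> {1..n} \<Longrightarrow> r \<noteq> s \<Longrightarrow> x r * q ^ i \<noteq> x s * q ^ j"
    "r \<in> {1..n} \<Longrightarrow> s \<in> {1..n} \<Longrightarrow> r \<noteq> s \<Longrightarrow> x r \<noteq> x s"
  using assms unfolding q_generic_def by (blast, blast, blast, blast, metis mult.right_neutral power_0)

lemma q_generic_shift:
  assumes "q_generic q n x"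
  shows "q_generic q n (\<lambda>r. x r * q ^ m r)"
  using assms unfolding q_generic_def by (simp add: mult.assoc power_add[symmetric])

lemma q_generic_ratio:
  assumes "q_generic q n x" "r \<in> {1..n}" "s \<in> {1..n}"
  shows "x r * q ^ Suc i / x s * q ^ j \<noteq> 1"
proof (cases "r = s")
  case True
  have "q ^ (Suc i + j) \<noteq> 1" by (rule q_genericD(2)[OF assms(1)]) simp
  then show ?thesis using True q_genericD(3)[OF assms(1,2)] by (simp add: power_add mult.assoc)
next
  case False
  then have "x r * q ^ (Suc i + j) \<noteq> x s * q ^ 0" by (intro q_genericD(4)[OF assms(1)] assms)
  then show ?thesis using q_genericD(3)[OF assms(1,3)] by (simp add: power_add field_simps)
qed

lemma qpoch_ratio_nonzero:
  assumes "q_generic q n x" "r \<in> {1..n}" "s \<in> {1..n}"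
  shows "qpoch q (q * x r / x s) k \<noteq> 0"
  using q_generic_ratio[OF assms, of 0] by (auto simp: qpoch_eq_0_iff mult_ac)

text \<open>Raising \<open>k u\<close> by one affects only the pairs containing \<open>u\<close> and
  the row \<open>r = u\<close> of the double product. The two weights are the summands of
  \<open>sum_prod_linear_quot\<close> at the points \<open>x s * q ^ k s\<close> and
  \<open>x s * q ^ k' s\<close>; stating the ratio as a product avoids dividing by a weight that may
  vanish.\<close>

lemma milne_term_Suc:
  assumes gen: "q_generic q n x" and u: "u \<in> {1..n}"
    and k_def: "k = k'(u := Suc (k' u))"
  shows "milne_term q n x c k *
      ((1 - q ^ k u) * (\<Prod>s\<in>{1..n} - {u}. (x s * q ^ k s - q ^ k s * (x u * q ^ k u)) / (x s * q ^ k s - x u * q ^ k u)))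
    = milne_term q n x c k' *
      ((1 - c u * q ^ k' u) * (\<Prod>s\<in>{1..n} - {u}. (x s * q ^ k' s - c s * q ^ k' s * (x u * q ^ k' u)) / (x s * q ^ k' s - x u * q ^ k' u)))"
proof -
  note g = q_genericD[OF gen]
  define X where "X s = x s * q ^ k' s" for s
  define J where "J = {1..n} - {u}"
  have I: "{1..n} = insert u J" "u \<notin> J" "finite J" using u by (auto simp: J_def)
  have kne: "k s = k' s" if "s \<noteq> u" for s using that by (simp add: k_def)
  have ku: "k u = Suc (k' u)" by (simp add: k_def)
  have X: "X s \<noteq> 0" if "s \<in> {1..n}" for s using g(1) g(3)[OF that] by (simp add: X_def)
  have d: "X s - X u \<noteq> 0" "X s - q * X u \<noteq> 0" if "s \<in> J" for s
    using that g(4)[of s u "k' s" "k' u"] g(4)[of s u "k' s" "Suc (k' u)"] u by (auto simp: X_def J_def mult_ac)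
  define h where "h k r s = (x s * q ^ k s - x r * q ^ k r) / (x s - x r)" for k and r s :: nat
  have hsym: "h k r s = h k s r" for k r s
    unfolding h_def by (metis minus_diff_eq minus_divide_divide)
  have W: "vandermonde_ratio q n x k = vandermonde_ratio q n x k' * (\<Prod>s\<in>J. (X s - q * X u) / (X s - X u))"
  proof -
    have "(\<Prod>(r, s)\<in>{(r, s)\<in>ordered_pairs n. r \<noteq> u \<and> s \<noteq> u}. h k r s)
       = (\<Prod>(r, s)\<in>{(r, s)\<in>ordered_pairs n. r \<noteq> u \<and> s \<noteq> u}. h k' r s)"
      by (rule prod.cong) (auto simp: h_def kne)
    moreover have "(\<Prod>s\<in>J. h k u s) = (\<Prod>s\<in>J. h k' u s) * (\<Prod>s\<in>J. (X s - q * X u) / (X s - X u))"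
      unfolding prod.distrib[symmetric]
    proof (rule prod.cong[OF refl])
      fix s assume s: "s \<in> J"
      then show "h k u s = h k' u s * ((X s - q * X u) / (X s - X u))"
        using d(1)[OF s] kne[of s] ku
        by (simp add: h_def X_def J_def mult_ac)
    qed
    ultimately show ?thesis
      unfolding vandermonde_ratio_def h_def[symmetric]
      using prod_ordered_pairs_split[OF u, of "h k", OF hsym]
        prod_ordered_pairs_split[OF u, of "h k'", OF hsym]
      by (simp add: J_def mult.assoc)
  qed
  define p where "p k r s = qpoch q (c s * x r / x s) (k r) / qpoch q (q * x r / x s) (k r)" for k and r s :: nat
  have P: "(\<Prod>r=1..n. \<Prod>s=1..n. p k r s) = (\<Prod>r=1..n. \<Prod>s=1..n. p k' r s) *
     (\<Prod>s=1..n. (1 - c s * x u / x s * q ^ k' u) / (1 - q * x u / x s * q ^ k' u))"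
  proof -
    have "(\<Prod>s=1..n. p k u s) = (\<Prod>s=1..n. p k' u s) *
     (\<Prod>s=1..n. (1 - c s * x u / x s * q ^ k' u) / (1 - q * x u / x s * q ^ k' u))"
      unfolding prod.distrib[symmetric] by (simp add: p_def ku qpoch_Suc)
    moreover have "p k r s = p k' r s" if "r \<in> J" for r s
      using that kne[of r] by (auto simp: p_def J_def)
    ultimately show ?thesis using I by (simp add: mult_ac)
  qed
  have "(\<Prod>s\<in>J. (X s - q * X u) / (X s - X u)) *
     (\<Prod>s=1..n. (1 - c s * x u / x s * q ^ k' u) / (1 - q * x u / x s * q ^ k' u)) *
     ((1 - q ^ k u) * (\<Prod>s\<in>J. (x s * q ^ k s - q ^ k s * (x u * q ^ k u)) / (x s * q ^ k s - x u * q ^ k u)))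
    = (1 - c u * q ^ k' u) * (\<Prod>s\<in>J. (x s * q ^ k' s - c s * q ^ k' s * (x u * q ^ k' u)) / (x s * q ^ k' s - x u * q ^ k' u))"
    (is "?A * ?B * (?C * ?D) = ?E * ?F")
  proof -
    \<comment> \<open>The diagonal factor \<open>s = u\<close> supplies \<open>?E / ?C\<close>; the
      remaining factors match \<open>?A\<close>, \<open>?D\<close> and \<open>?F\<close> one by
      one.\<close>
    have "?B = ((1 - c u * q ^ k' u) / (1 - q ^ k u)) * (\<Prod>s\<in>J. (1 - c s * x u / x s * q ^ k' u) / (1 - q * x u / x s * q ^ k' u))"
      (is "_ = _ * ?B'")
      using I g(3)[OF u] by (simp add: ku)
    moreover have "1 - q ^ k u \<noteq> 0" using g(2)[of "k u"] by (simp add: ku)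
    moreover have "?A * ?B' * ?D = ?F"
      unfolding prod.distrib[symmetric]
    proof (rule prod.cong[OF refl])
      fix s assume s: "s \<in> J"
      then have s': "s \<in> {1..n}" "s \<noteq> u" by (auto simp: J_def)
      have xs: "x s \<noteq> 0" using g(3) s' by blast
      have e: "x s - q * x u * q ^ k' u \<noteq> 0"
        using g(4)[of s u 0 "Suc (k' u)"] s' u by (auto simp: mult_ac)
      have b: "(1 - c s * x u / x s * q ^ k' u) / (1 - q * x u / x s * q ^ k' u)
          = (x s - c s * x u * q ^ k' u) / (x s - q * x u * q ^ k' u)"
        using xs e by (simp add: divide_simps)
      have "(X s - q * X u) / (X s - X u) * ((x s - c s * x u * q ^ k' u) / (x s - q * x u * q ^ k' u)) *
        (q ^ k' s * (x s - q * x u * q ^ k' u) / (X s - q * X u)) = q ^ k' s * (x s - c s * x u * q ^ k' u) / (X s - X u)"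
        using d[OF s] e by (simp add: divide_simps)
      then show "(X s - q * X u) / (X s - X u) * ((1 - c s * x u / x s * q ^ k' u) / (1 - q * x u / x s * q ^ k' u)) *
         ((x s * q ^ k s - q ^ k s * (x u * q ^ k u)) / (x s * q ^ k s - x u * q ^ k u))
        = (x s * q ^ k' s - c s * q ^ k' s * (x u * q ^ k' u)) / (x s * q ^ k' s - x u * q ^ k' u)"
        unfolding b using kne[of s] ku s' by (simp add: X_def algebra_simps)
    qed
    moreover have "?A * (?E / ?C * ?B') * (?C * ?D) = (?E / ?C * ?C) * (?A * ?B' * ?D)"
      by (simp only: mult_ac)
    ultimately show ?thesis by simp
  qed
  then show ?thesis
    unfolding milne_term_def p_def[symmetric] P W J_def[symmetric] by (simp only: mult_ac)
qed

section \<open>Multi-indices of fixed size and Milne's summation over them\<close>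

definition compositions :: "nat \<Rightarrow> nat \<Rightarrow> (nat \<Rightarrow> nat) set" where
  "compositions n j = {k \<in> multi_indices n. msize n k = j}"

lemma finite_compositions: "finite (compositions n j)"
proof (rule finite_subset)
  show "compositions n j \<subseteq> {1..n} \<rightarrow>\<^sub>E {..j}"
    by (auto simp: compositions_def multi_indices_def msize_def PiE_iff extensional_def intro: member_le_sum)
qed (auto intro: finite_PiE)

lemma compositions_0: "compositions n 0 = {\<lambda>r\<in>{1..n}. 0}"
  by (auto simp: compositions_def multi_indices_def msize_def fun_eq_iff PiE_iff extensional_def)

lemma msize_upd_Suc: "u \<in> {1..n} \<Longrightarrow> msize n (k(u := Suc (k u))) = Suc (msize n k)"
  unfolding msize_def by (subst (1 2) sum.remove[of _ u]) auto

text \<open>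
  With \<open>F\<^sub>j\<close> the left-hand side, \<open>(1 - q\<^bsup>j+1\<^esup>) F\<^bsub>j+1\<^esub> = (1 - C q\<^sup>j) F\<^sub>j\<close> where \<open>C\<close> is the product of the
  \<open>c\<^sub>r\<close>: both factors are expanded as sums over \<open>u\<close> by partial fractions, at \<open>x\<^sub>r q\<^bsup>k\<^sub>r\<^esup>\<close>, and
  the expansions match term by term under \<open>k \<mapsto> k + e\<^sub>u\<close>.
\<close>

lemma milne_fundamental:
  assumes gen: "q_generic q n x"
  shows "(\<Sum>k\<in>compositions n j. milne_term q n x c k) = qpoch q (\<Prod>r=1..n. c r) j / qpoch q q j"
proof (induction j)
  case 0
  define z where "z = (\<lambda>r\<in>{1..n}. 0 :: nat)"
  have z: "z r = 0" if "r \<in> {1..n}" for r using that by (simp add: z_def)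
  have "vandermonde_ratio q n x z = 1"
    unfolding vandermonde_ratio_def
    using q_genericD(5)[OF gen] by (intro prod.neutral) (auto simp: ordered_pairs_def z)
  then show ?case
    unfolding compositions_0 z_def[symmetric] by (simp add: milne_term_def z)
next
  case (Suc j)
  note g = q_genericD[OF gen]
  let ?T = "milne_term q n x c"
  define w where "w c k u = (1 - c u * q ^ k u) *
    (\<Prod>s\<in>{1..n} - {u}. (x s * q ^ k s - c s * q ^ k s * (x u * q ^ k u)) / (x s * q ^ k s - x u * q ^ k u))"
    for c :: "nat \<Rightarrow> complex" and k :: "nat \<Rightarrow> nat" and u
  have w: "(\<Sum>u=1..n. w c k u) = 1 - (\<Prod>r=1..n. c r) * q ^ msize n k" for c k
  proof -
    have "inj_on (\<lambda>r. x r * q ^ k r) {1..n}" using g(4) unfolding inj_on_def by blast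
    from sum_prod_linear_quot[OF _ this, of "\<lambda>r. c r * q ^ k r"] show ?thesis
      by (simp add: w_def msize_def prod.distrib power_sum)
  qed
  define v where "v k u = (1 - q ^ k u) *
    (\<Prod>s\<in>{1..n} - {u}. (x s * q ^ k s - q ^ k s * (x u * q ^ k u)) / (x s * q ^ k s - x u * q ^ k u))"
    for k :: "nat \<Rightarrow> nat" and u
  have v: "(\<Sum>u=1..n. v k u) = 1 - q ^ msize n k" for k
    using w[of "\<lambda>_. 1" k] by (simp add: w_def v_def)
  have "(1 - q ^ Suc j) * (\<Sum>k\<in>compositions n (Suc j). ?T k)
      = (\<Sum>k\<in>compositions n (Suc j). \<Sum>u=1..n. ?T k * v k u)"
    unfolding sum_distrib_left[symmetric] v by (simp add: compositions_def sum_distrib_right[symmetric] mult.commute)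
  also have "\<dots> = (\<Sum>u=1..n. \<Sum>k\<in>compositions n (Suc j). ?T k * v k u)"
    by (rule sum.swap)
  also have "\<dots> = (\<Sum>u=1..n. \<Sum>k\<in>compositions n j. ?T k * w c k u)"
  proof (rule sum.cong[OF refl])
    fix u assume u: "u \<in> {1..n}"
    \<comment> \<open>The weight \<open>v k u\<close> contains \<open>1 - q ^ k u\<close>, which is
      0 when \<open>k u = 0\<close>; on the remaining indices, lowering entry \<open>u\<close> is a
      bijection onto the compositions of \<open>j\<close>.\<close>
    have "(\<Sum>k\<in>compositions n (Suc j). ?T k * v k u) = (\<Sum>k\<in>{k\<in>compositions n (Suc j). k u > 0}. ?T k * v k u)"
      by (intro sum.mono_neutral_right finite_compositions) (auto simp: v_def)
    also have "\<dots> = (\<Sum>k\<in>compositions n j. ?T k * w c k u)"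
    proof (rule sum.reindex_bij_witness[of _ "\<lambda>k. k(u := Suc (k u))" "\<lambda>k. k(u := k u - 1)"])
      fix k assume k: "k \<in> {k\<in>compositions n (Suc j). k u > 0}"
      define k' where "k' = k(u := k u - 1)"
      have kk: "k = k'(u := Suc (k' u))" using k by (auto simp: k'_def)
      then show "k(u := k u - 1) \<in> compositions n j"
        using k msize_upd_Suc[OF u, of k'] u
        by (auto simp: compositions_def multi_indices_def k'_def[symmetric] PiE_iff extensional_def)
      show "?T (k(u := k u - 1)) * w c (k(u := k u - 1)) u = ?T k * v k u"
        using milne_term_Suc[OF gen u kk, of c] unfolding k'_def[symmetric] w_def v_def by simp
      show "(k(u := k u - 1))(u := Suc ((k(u := k u - 1)) u)) = k"
        using k by auto
    next
      fix k assume "k \<in> compositions n j"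
      then show "k(u := Suc (k u)) \<in> {k\<in>compositions n (Suc j). k u > 0}"
        using msize_upd_Suc[OF u, of k] u
        by (auto simp: compositions_def multi_indices_def PiE_iff extensional_def)
    qed auto
    finally show "(\<Sum>k\<in>compositions n (Suc j). ?T k * v k u) = (\<Sum>k\<in>compositions n j. ?T k * w c k u)" .
  qed
  also have "\<dots> = (\<Sum>k\<in>compositions n j. \<Sum>u=1..n. ?T k * w c k u)"
    by (rule sum.swap)
  also have "\<dots> = (1 - (\<Prod>r=1..n. c r) * q ^ j) * (\<Sum>k\<in>compositions n j. ?T k)"
    unfolding sum_distrib_left[symmetric] w by (simp add: compositions_def sum_distrib_right[symmetric] mult.commute)
  finally have "(\<Sum>k\<in>compositions n (Suc j). ?T k) =
      (1 - (\<Prod>r=1..n. c r) * q ^ j) * (\<Sum>k\<in>compositions n j. ?T k) / (1 - q ^ Suc j)"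
    using g(2)[of "Suc j"] by (simp add: eq_divide_eq mult.commute del: power_Suc)
  then show ?case
    unfolding Suc by (simp add: qpoch_Suc mult_ac)
qed

subsection \<open>Bailey inversion\<close>

lemma qpoch_inverse_power_eq_0: "L < l \<Longrightarrow> q \<noteq> 0 \<Longrightarrow> qpoch q (1 / q ^ L) l = 0"
  by (auto simp: qpoch_eq_0_iff intro!: exI[of _ L])

text \<open>The quotient itself is \<open>(-1) ^ j\<close> divided by \<open>q\<close> to the power
  \<open>j * (j + 1) / 2\<close>. Only its square is needed, which avoids the sign and the halved
  exponent.\<close>

lemma qpoch_inverse_power_quot_sq:
  assumes "q \<noteq> 0" "\<And>j. j > 0 \<Longrightarrow> q ^ j \<noteq> 1"
  shows "(qpoch q (1 / q ^ j) j / qpoch q q j)\<^sup>2 * q ^ (j * j + j) = 1"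
proof (induction j)
  case (Suc j)
  have ne: "1 - q ^ Suc j \<noteq> 0" using assms(2)[of "Suc j"] by simp
  have 1: "qpoch q (1 / q ^ Suc j) (Suc j) = (1 - 1 / q ^ Suc j) * qpoch q (1 / q ^ j) j"
    using qpoch_add[of q "1 / q ^ Suc j" 1 j] assms(1) by (simp add: qpoch_Suc[of _ _ 0, simplified])
  have 2: "qpoch q q (Suc j) = (1 - q ^ Suc j) * qpoch q q j" by (simp add: qpoch_Suc)
  have 3: "(1 - 1 / q ^ Suc j) / (1 - q ^ Suc j) = - (1 / q ^ Suc j)"
    using ne assms(1) by (simp add: field_simps)
  have e: "qpoch q (1 / q ^ Suc j) (Suc j) / qpoch q q (Suc j)
      = - (1 / q ^ Suc j) * (qpoch q (1 / q ^ j) j / qpoch q q j)"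
    unfolding 1 2 times_divide_times_eq[symmetric] 3 ..
  have e2: "q ^ (Suc j * Suc j + Suc j) = q ^ (j * j + j) * (q ^ Suc j)\<^sup>2"
  proof -
    have "Suc j * Suc j + Suc j = (j * j + j) + Suc j * 2" by simp
    then show ?thesis by (simp only: power_add power_mult)
  qed
  have key: "(- (1 / t) * R)\<^sup>2 * (Q * t\<^sup>2) = R\<^sup>2 * Q" if "t \<noteq> 0" for t R Q :: complex
    using that by (simp add: field_simps power2_eq_square)
  show ?case
    unfolding e e2 by (subst key) (use Suc assms(1) in auto)
qed simp

section \<open>Milne's summation on boxes of multi-indices\<close>

lemma finite_multi_indices_le [simp]: "finite (multi_indices_le n k)"
  unfolding multi_indices_le_def by (intro finite_PiE) auto

lemma msize_mono: "(\<And>r. r \<in> {1..n} \<Longrightarrow> k r \<le> l r) \<Longrightarrow> msize n k \<le> msize n l"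
  unfolding msize_def by (rule sum_mono)

text \<open>The diagonal factor \<open>s = r\<close> has the numerator
  \<open>qpoch q (1 / q ^ L r) (l r)\<close>, which is 0. This makes the series terminate.\<close>

lemma milne_term_eq_0:
  assumes "q_generic q n x" "r \<in> {1..n}" "L r < l r"
  shows "milne_term q n x (\<lambda>s. 1 / q ^ L s) l = 0"
proof -
  have "qpoch q (1 / q ^ L r * x r / x r) (l r) = 0"
    using assms q_genericD[OF assms(1)] by (simp add: qpoch_inverse_power_eq_0)
  then show ?thesis
    using assms(2) unfolding milne_term_def by (auto intro!: prod_zero bexI[of _ r])
qed

text \<open>Terms outside the box vanish, so the box may be enlarged to all indices of size at most
  \<open>msize n L\<close>. Grouped by size, each layer is evaluated by
  \<open>milne_fundamental\<close>, leaving a one-variable sum.\<close>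

lemma sum_milne_term_box:
  assumes gen: "q_generic q n x"
  shows "(\<Sum>l\<in>multi_indices_le n L. milne_term q n x (\<lambda>s. 1 / q ^ L s) l * g (msize n l))
    = (\<Sum>j\<le>msize n L. qpoch q (1 / q ^ msize n L) j / qpoch q q j * g j)"
proof -
  let ?T = "milne_term q n x (\<lambda>s. 1 / q ^ L s)"
  have "(\<Sum>l\<in>multi_indices_le n L. ?T l * g (msize n l))
      = (\<Sum>l\<in>(\<Union>j\<in>{..msize n L}. compositions n j). ?T l * g (msize n l))"
  proof (rule sum.mono_neutral_left)
    show "multi_indices_le n L \<subseteq> (\<Union>j\<in>{..msize n L}. compositions n j)"
      using msize_mono[of n _ L]
      by (auto simp: multi_indices_le_def compositions_def multi_indices_def PiE_iff)
    show "\<forall>l\<in>(\<Union>j\<in>{..msize n L}. compositions n j) - multi_indices_le n L. ?T l * g (msize n l) = 0"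
    proof
      fix l assume "l \<in> (\<Union>j\<in>{..msize n L}. compositions n j) - multi_indices_le n L"
      then obtain r where "r \<in> {1..n}" "L r < l r"
        by (auto simp: compositions_def multi_indices_def multi_indices_le_def PiE_iff not_le)
      then show "?T l * g (msize n l) = 0" using milne_term_eq_0[OF gen] by simp
    qed
  qed (auto simp: finite_compositions)
  also have "\<dots> = (\<Sum>j\<le>msize n L. \<Sum>l\<in>compositions n j. ?T l * g (msize n l))"
    by (rule sum.UNION_disjoint) (simp_all add: finite_compositions, auto simp: compositions_def)
  also have "\<dots> = (\<Sum>j\<le>msize n L. (\<Sum>l\<in>compositions n j. ?T l) * g j)"
    by (simp add: compositions_def sum_distrib_right)
  also have "\<dots> = (\<Sum>j\<le>msize n L. qpoch q (1 / q ^ msize n L) j / qpoch q q j * g j)"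
    unfolding milne_fundamental[OF gen] by (simp add: msize_def prod_dividef power_sum)
  finally show ?thesis .
qed

lemma multi_indices_le_eqI:
  assumes "l \<in> multi_indices_le n L" "L \<in> multi_indices n" "msize n l = msize n L"
  shows "l = L"
proof (rule ccontr)
  assume "l \<noteq> L"
  then obtain r where r: "l r \<noteq> L r" by auto
  have "r \<in> {1..n}"
  proof (rule ccontr)
    assume "r \<notin> {1..n}"
    then have "l r = undefined" "L r = undefined"
      using assms(1,2) unfolding multi_indices_le_def multi_indices_def by (blast intro: PiE_arb)+
    with r show False by simp
  qed
  moreover note r
  moreover have "l s \<le> L s" if "s \<in> {1..n}" for s
    using assms(1) that by (auto simp: multi_indices_le_def)
  ultimately have "msize n l < msize n L"
    unfolding msize_def by (intro sum_strict_mono_ex1) (auto intro!: bexI[of _ r] simp: le_neq_implies_less)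
  then show False using assms(3) by simp
qed

text \<open>In the box below \<open>L\<close> only \<open>L\<close> itself has size
  \<open>msize n L\<close>, so taking the indicator of that size as \<open>g\<close> in the box
  summation evaluates this single term.\<close>

lemma milne_term_top:
  assumes gen: "q_generic q n x" and L: "L \<in> multi_indices n"
  shows "milne_term q n x (\<lambda>s. 1 / q ^ L s) L = qpoch q (1 / q ^ msize n L) (msize n L) / qpoch q q (msize n L)"
proof -
  let ?T = "milne_term q n x (\<lambda>s. 1 / q ^ L s)"
  have "(\<Sum>l\<in>multi_indices_le n L. ?T l * of_bool (msize n l = msize n L))
     = (\<Sum>l\<in>{L}. ?T l * of_bool (msize n l = msize n L))"
    using L multi_indices_le_eqI[of _ n L]
    by (intro sum.mono_neutral_right) (simp, auto simp: multi_indices_le_def multi_indices_def PiE_iff)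
  with sum_milne_term_box[OF gen, of L "\<lambda>j. of_bool (j = msize n L)"]
  show ?thesis by (simp add: of_bool_def if_distrib sum.If_cases cong: if_cong)
qed

text \<open>Lowering a base \<open>z\<close> to \<open>z / q\<close> trades the factor at one end of
  the product for one at the other end; in terms of \<open>q / z\<close> this costs a factor
  \<open>q ^ p\<close>. Iterated \<open>l\<close> times, it rewrites numerators whose base depends
  on \<open>m + l\<close> by ones that depend on \<open>m\<close> alone.\<close>

lemma qpoch_base_change:
  assumes "q \<noteq> 0" "y \<noteq> 0"
  shows "qpoch q (y / q ^ (m + l)) p * q ^ (l * p) * qpoch q (q * (1 / y * q ^ m) / q ^ p) l
    = qpoch q (y / q ^ m) p * qpoch q (q * (1 / y * q ^ m)) l"
proof (induction l)
  case (Suc l)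
  define z where "z = y / q ^ (m + l)"
  have z: "z \<noteq> 0" using assms by (simp add: z_def)
  have zq: "y / q ^ (m + Suc l) = z / q" by (simp add: z_def)
  have yz: "1 / y * q ^ m * q ^ l = 1 / z" using assms by (simp add: z_def power_add)
  have "(1 - z / q) * qpoch q z p = qpoch q (z / q) p * (1 - z / q * q ^ p)"
    using qpoch_add[of q "z / q" 1 p] qpoch_Suc[of q "z / q" p] assms(1)
    by (simp add: qpoch_Suc[of _ _ 0, simplified])
  moreover have "q ^ p - q / z = (1 - z / q * q ^ p) * (- (q / z))"
    using assms(1) z by (simp add: field_simps)
  ultimately have *: "qpoch q (z / q) p * (q ^ p - q / z) = (1 - q / z) * qpoch q z p"
    using assms(1) z by (simp add: field_simps)
  have e1: "1 - q * (1 / y * q ^ m) / q ^ p * q ^ l = (q ^ p - q / z) / q ^ p"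
  proof -
    have "q * (1 / y * q ^ m) / q ^ p * q ^ l = q * (1 / y * q ^ m * q ^ l) / q ^ p" by simp
    then show ?thesis unfolding yz using assms(1) by (simp add: diff_divide_distrib)
  qed
  have e2: "1 - q * (1 / y * q ^ m) * q ^ l = 1 - q / z"
  proof -
    have "q * (1 / y * q ^ m) * q ^ l = q * (1 / y * q ^ m * q ^ l)" by simp
    then show ?thesis unfolding yz by simp
  qed
  have "qpoch q (z / q) p * q ^ (Suc l * p) * qpoch q (q * (1 / y * q ^ m) / q ^ p) (Suc l)
     = (qpoch q (z / q) p * (q ^ p - q / z)) * q ^ (l * p) * qpoch q (q * (1 / y * q ^ m) / q ^ p) l"
    unfolding qpoch_Suc e1 using assms(1) by (simp add: power_add mult_ac)
  also have "\<dots> = (1 - q / z) * (qpoch q z p * q ^ (l * p) * qpoch q (q * (1 / y * q ^ m) / q ^ p) l)"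
    unfolding * by (simp only: mult_ac)
  also have "\<dots> = qpoch q (y / q ^ m) p * qpoch q (q * (1 / y * q ^ m)) (Suc l)"
    unfolding qpoch_Suc e2 using Suc by (simp add: z_def mult_ac)
  finally show ?case unfolding zq .
qed simp

text \<open>The Vandermonde determinant at the intermediate points \<open>x r * q ^ m r\<close>
  cancels; genericity keeps it nonzero.\<close>

lemma vandermonde_ratio_add:
  assumes gen: "q_generic q n x" and k: "\<And>r. r \<in> {1..n} \<Longrightarrow> k r = m r + l r"
  shows "vandermonde_ratio q n x k = vandermonde_ratio q n x m * vandermonde_ratio q n (\<lambda>r. x r * q ^ m r) l"
  unfolding vandermonde_ratio_def prod.distrib[symmetric]
proof (rule prod.cong[OF refl], clarify)
  fix r s assume "(r, s) \<in> ordered_pairs n"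
  then have rs: "r \<in> {1..n}" "s \<in> {1..n}" "r \<noteq> s" by (auto simp: ordered_pairs_def)
  then have "x s * q ^ m s - x r * q ^ m r \<noteq> 0" using q_genericD(4)[OF gen, of s r] by auto
  then show "(x s * q ^ k s - x r * q ^ k r) / (x s - x r) =
    (x s * q ^ m s - x r * q ^ m r) / (x s - x r) *
    ((x s * q ^ m s * q ^ l s - x r * q ^ m r * q ^ l r) / (x s * q ^ m s - x r * q ^ m r))"
    using k[OF rs(1)] k[OF rs(2)] by (simp add: power_add mult.assoc)
qed

text \<open>Separates the dependence on \<open>l\<close> when \<open>k = m + l\<close>. The first
  term splits by \<open>qpoch_add\<close>, and \<open>qpoch_base_change\<close> removes
  \<open>l\<close> from the numerators of the second. What still depends on \<open>l\<close> is one
  Milne term at the shifted points, and the power of \<open>q\<close> gathers the cost of the base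
  changes.\<close>

lemma milne_term_shift:
  assumes gen: "q_generic q n x"
    and k: "\<And>r. r \<in> {1..n} \<Longrightarrow> k r = m r + l r"
    and K: "\<And>r. r \<in> {1..n} \<Longrightarrow> K r = m r + L r"
  shows "milne_term q n x (\<lambda>s. 1 / q ^ K s) k * milne_term q n x (\<lambda>s. 1 / q ^ k s) m * q ^ (msize n l * msize n m)
    = milne_term q n x (\<lambda>s. 1 / q ^ K s) m * milne_term q n x (\<lambda>s. 1 / q ^ m s) m *
      milne_term q n (\<lambda>r. x r * q ^ m r) (\<lambda>s. 1 / q ^ L s) l"
proof -
  note g = q_genericD[OF gen]
  define P where "P r s = qpoch q (1 / q ^ K s * x r / x s) (m r) / qpoch q (q * x r / x s) (m r)" for r s
  define Q where "Q r s = qpoch q (1 / q ^ L s * (x r * q ^ m r) / (x s * q ^ m s)) (l r)" for r s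
  define D where "D r s = qpoch q (q * (x r * q ^ m r) / x s) (l r)" for r s
  define D' where "D' r s = qpoch q (q * (x r * q ^ m r) / (x s * q ^ m s)) (l r)" for r s
  define E where "E c r s = qpoch q (1 / q ^ c s * x r / x s) (m r)" for c :: "nat \<Rightarrow> nat" and r s
  define F where "F r s = qpoch q (q * x r / x s) (m r)" for r s
  have nz: "F r s \<noteq> 0" "D r s \<noteq> 0" "D' r s \<noteq> 0" if "r \<in> {1..n}" "s \<in> {1..n}" for r s
  proof -
    show "F r s \<noteq> 0" unfolding F_def by (rule qpoch_ratio_nonzero[OF gen that])
    show "D r s \<noteq> 0" unfolding D_def qpoch_eq_0_iff
      using q_generic_ratio[OF gen that, of "m r"] by (auto simp: mult_ac)
    show "D' r s \<noteq> 0" unfolding D'_def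
      by (rule qpoch_ratio_nonzero[OF q_generic_shift[OF gen] that])
  qed
  have 1: "qpoch q (1 / q ^ K s * x r / x s) (k r) / qpoch q (q * x r / x s) (k r) = P r s * (Q r s / D r s)"
    if "r \<in> {1..n}" "s \<in> {1..n}" for r s
    using k[OF that(1)] K[OF that(2)] by (simp add: qpoch_add P_def Q_def D_def power_add mult_ac)
  \<comment> \<open>\<open>D\<close> and \<open>D'\<close> occur with transposed indices, which is
    harmless in the full double product. There the identity trades the denominators \<open>D\<close>
    of the first term for the denominators \<open>D'\<close> of the shifted one.\<close>
  have 2: "E k r s * q ^ (l s * m r) * D' s r = E m r s * D s r"
    if "r \<in> {1..n}" "s \<in> {1..n}" for r s
    using qpoch_base_change[of q "x r / x s" "m s" "l s" "m r"] g(1) g(3)[OF that(1)] g(3)[OF that(2)] k[OF that(2)]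
    by (simp add: E_def D_def D'_def mult_ac)
  have "(\<Prod>r=1..n. \<Prod>s=1..n. q ^ (l s * m r)) = q ^ (msize n l * msize n m)"
  proof -
    have "(\<Prod>r=1..n. \<Prod>s=1..n. q ^ (l s * m r)) = q ^ (\<Sum>r=1..n. \<Sum>s=1..n. l s * m r)"
      by (simp add: power_sum)
    also have "(\<Sum>r=1..n. \<Sum>s=1..n. l s * m r) = msize n l * msize n m"
      unfolding msize_def sum_product by (rule sum.swap)
    finally show ?thesis .
  qed
  then have "(\<Prod>r=1..n. \<Prod>s=1..n. E k r s) * q ^ (msize n l * msize n m) * (\<Prod>r=1..n. \<Prod>s=1..n. D' r s)
     = (\<Prod>r=1..n. \<Prod>s=1..n. E k r s * q ^ (l s * m r) * D' s r)"
    unfolding prod.distrib using prod.swap[of D' "{1..n}" "{1..n}"] by simp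
  also have "\<dots> = (\<Prod>r=1..n. \<Prod>s=1..n. E m r s * D s r)"
    using 2 by (intro prod.cong refl) auto
  also have "\<dots> = (\<Prod>r=1..n. \<Prod>s=1..n. E m r s) * (\<Prod>r=1..n. \<Prod>s=1..n. D r s)"
    unfolding prod.distrib using prod.swap[of D "{1..n}" "{1..n}"] by simp
  finally have 3: "(\<Prod>r=1..n. \<Prod>s=1..n. E k r s) * q ^ (msize n l * msize n m) / (\<Prod>r=1..n. \<Prod>s=1..n. D r s)
     = (\<Prod>r=1..n. \<Prod>s=1..n. E m r s) / (\<Prod>r=1..n. \<Prod>s=1..n. D' r s)"
    using nz(2,3) by (simp add: frac_eq_eq)
  have 4: "(\<Prod>r=1..n. \<Prod>s=1..n. qpoch q (1 / q ^ K s * x r / x s) (k r) / qpoch q (q * x r / x s) (k r))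
    = (\<Prod>r=1..n. \<Prod>s=1..n. P r s * (Q r s / D r s))"
    using 1 by (intro prod.cong refl) auto
  let ?PP = "\<lambda>f. \<Prod>r=1..n. \<Prod>s=1..n. f r s :: complex"
  have "?PP P * (?PP Q / ?PP D) * (?PP (E k) / ?PP F) * q ^ (msize n l * msize n m)
      = ?PP P * (?PP Q / ?PP F) * (?PP (E k) * q ^ (msize n l * msize n m) / ?PP D)"
    by (simp add: mult_ac)
  also have "\<dots> = ?PP P * (?PP (E m) / ?PP F) * (?PP Q / ?PP D')"
    unfolding 3 by simp
  finally have 5: "?PP P * (?PP Q / ?PP D) * (?PP (E k) / ?PP F) * q ^ (msize n l * msize n m)
      = ?PP P * (?PP (E m) / ?PP F) * (?PP Q / ?PP D')" .
  have W: "vandermonde_ratio q n x k = vandermonde_ratio q n x m * vandermonde_ratio q n (\<lambda>r. x r * q ^ m r) l"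
    by (rule vandermonde_ratio_add[OF gen]) (rule k)
  show ?thesis
    unfolding milne_term_def 4 W
    unfolding P_def[symmetric]
    unfolding E_def[symmetric] Q_def[symmetric] D'_def[symmetric] F_def[symmetric]
      prod.distrib prod_dividef
    using arg_cong[OF 5, of "\<lambda>t. vandermonde_ratio q n x m * vandermonde_ratio q n x m *
      vandermonde_ratio q n (\<lambda>r. x r * q ^ m r) l * t"] by (simp only: mult_ac)
qed

text \<open>The coefficient of the inner term \<open>m\<close> after the two sums are exchanged.
  Substituting \<open>k = m + l\<close> turns it into a sum over a box, which collapses to the
  very-well-poised sum with \<open>A = \<alpha> * q ^ (2 * M)\<close> and length
  \<open>msize n L\<close>; this is 0 unless \<open>L\<close> has size 0, that is, unless
  \<open>m = K\<close>.\<close>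

lemma bailey_inversion:
  assumes gen: "q_generic q n x" and K: "K \<in> multi_indices n" and m: "m \<in> multi_indices_le n K"
    and \<alpha>: "\<alpha> \<noteq> 1" "\<And>j. qpoch q (\<alpha> * q ^ Suc (msize n K)) j \<noteq> 0"
  shows "(\<Sum>k | k \<in> multi_indices_le n K \<and> (\<forall>r\<in>{1..n}. m r \<le> k r).
      milne_term q n x (\<lambda>s. 1 / q ^ K s) k * milne_term q n x (\<lambda>s. 1 / q ^ k s) m * q ^ (msize n K * msize n k) *
      ((1 - \<alpha> * q ^ (2 * msize n k)) * qpoch q \<alpha> (msize n k) /
        ((1 - \<alpha>) * qpoch q (\<alpha> * q ^ Suc (msize n K)) (msize n k))) *
      qpoch q (\<alpha> * q ^ msize n k) (msize n m))
    = (if m = K then qpoch q (\<alpha> * q) (msize n K) / q ^ msize n K else 0)"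
    (is "(\<Sum>k | _. ?h k) = _")
proof -
  note g = q_genericD[OF gen]
  define L where "L = (\<lambda>r\<in>{1..n}. K r - m r)"
  define add where "add l = (\<lambda>r\<in>{1..n}. m r + l r)" for l
  define M where "M = msize n m"
  define A where "A = \<alpha> * q ^ (2 * M)"
  have mK: "m r \<le> K r" if "r \<in> {1..n}" for r using m that by (auto simp: multi_indices_le_def)
  have KL: "K r = m r + L r" if "r \<in> {1..n}" for r using mK[OF that] that by (simp add: L_def)
  have sK: "msize n K = M + msize n L"
    unfolding msize_def M_def sum.distrib[symmetric] by (rule sum.cong) (auto simp: KL)
  have sadd: "msize n (add l) = M + msize n l" for l
    unfolding msize_def M_def sum.distrib[symmetric] by (rule sum.cong) (auto simp: add_def)
  \<comment> \<open>\<open>C\<close> collects everything independent of \<open>l\<close>, while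
    \<open>G\<close> sees \<open>l\<close> only through its size, as
    \<open>sum_milne_term_box\<close> requires.\<close>
  define C where "C = milne_term q n x (\<lambda>s. 1 / q ^ K s) m * milne_term q n x (\<lambda>s. 1 / q ^ m s) m *
     (q ^ (msize n K * M) * qpoch q \<alpha> (2 * M) / ((1 - \<alpha>) * qpoch q (\<alpha> * q ^ Suc (msize n K)) M))"
  define G where "G j = (1 - A * q ^ (2 * j)) * qpoch q A j / qpoch q (A * q ^ Suc (msize n L)) j * q ^ (msize n L * j)" for j
  have h: "?h (add l) = C * (milne_term q n (\<lambda>r. x r * q ^ m r) (\<lambda>s. 1 / q ^ L s) l * G (msize n l))" for l
  proof -
    let ?j = "msize n l"
    have T: "milne_term q n x (\<lambda>s. 1 / q ^ K s) (add l) * milne_term q n x (\<lambda>s. 1 / q ^ add l s) m * q ^ (?j * M)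
      = milne_term q n x (\<lambda>s. 1 / q ^ K s) m * milne_term q n x (\<lambda>s. 1 / q ^ m s) m *
      milne_term q n (\<lambda>r. x r * q ^ m r) (\<lambda>s. 1 / q ^ L s) l"
      unfolding M_def by (rule milne_term_shift[OF gen _ KL]) (auto simp: add_def)
    have q1: "q ^ (msize n K * msize n (add l)) = q ^ (?j * M) * (q ^ (msize n K * M) * q ^ (msize n L * ?j))"
      unfolding sadd sK power_add[symmetric] by (simp add: algebra_simps)
    \<comment> \<open>Both sides equal \<open>qpoch q \<alpha> (2 * M + ?j)\<close>: the inner
      factorial continues the outer one, which is what moves the base to \<open>A\<close>.\<close>
    have q2: "qpoch q \<alpha> (M + ?j) * qpoch q (\<alpha> * q ^ (M + ?j)) M = qpoch q \<alpha> (2 * M) * qpoch q A ?j"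
      unfolding A_def qpoch_add[symmetric] by (simp add: add_ac mult_2)
    have q3: "qpoch q (\<alpha> * q ^ Suc (msize n K)) (M + ?j)
       = qpoch q (\<alpha> * q ^ Suc (msize n K)) M * qpoch q (A * q ^ Suc (msize n L)) ?j"
      unfolding A_def qpoch_add sK mult_2 by (simp add: power_add mult_ac)
    have q4: "1 - \<alpha> * q ^ (2 * (M + ?j)) = 1 - A * q ^ (2 * ?j)"
      by (simp add: A_def power_add distrib_left)
    have "?h (add l) = (milne_term q n x (\<lambda>s. 1 / q ^ K s) (add l) * milne_term q n x (\<lambda>s. 1 / q ^ add l s) m * q ^ (?j * M))
       * (q ^ (msize n K * M) * q ^ (msize n L * ?j))
       * ((1 - A * q ^ (2 * ?j)) * (qpoch q \<alpha> (M + ?j) * qpoch q (\<alpha> * q ^ (M + ?j)) M)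
       / ((1 - \<alpha>) * (qpoch q (\<alpha> * q ^ Suc (msize n K)) M * qpoch q (A * q ^ Suc (msize n L)) ?j)))"
      unfolding q1 unfolding sadd q3 q4 M_def[symmetric] by (simp add: mult_ac)
    then show ?thesis unfolding T q2 C_def G_def by (simp add: mult_ac)
  qed
  have "(\<Sum>k | k \<in> multi_indices_le n K \<and> (\<forall>r\<in>{1..n}. m r \<le> k r). ?h k) = (\<Sum>l\<in>multi_indices_le n L. ?h (add l))"
  proof (rule sum.reindex_bij_witness[of _ add "\<lambda>k. \<lambda>r\<in>{1..n}. k r - m r"])
    fix k assume k: "k \<in> {k. k \<in> multi_indices_le n K \<and> (\<forall>r\<in>{1..n}. m r \<le> k r)}"
    then show kk: "add (\<lambda>r\<in>{1..n}. k r - m r) = k"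
      by (auto simp: add_def multi_indices_le_def PiE_iff extensional_def fun_eq_iff)
    show "(\<lambda>r\<in>{1..n}. k r - m r) \<in> multi_indices_le n L"
      using k by (auto simp: L_def multi_indices_le_def PiE_iff intro: diff_le_mono)
    show "?h (add (\<lambda>r\<in>{1..n}. k r - m r)) = ?h k" unfolding kk ..
  next
    fix l assume l: "l \<in> multi_indices_le n L"
    then show "(\<lambda>r\<in>{1..n}. add l r - m r) = l"
      by (auto simp: add_def multi_indices_le_def PiE_iff extensional_def fun_eq_iff)
    show "add l \<in> {k. k \<in> multi_indices_le n K \<and> (\<forall>r\<in>{1..n}. m r \<le> k r)}"
      using l KL by (auto simp: add_def multi_indices_le_def PiE_iff)
  qed
  also have "\<dots> = C * (\<Sum>j\<le>msize n L. qpoch q (1 / q ^ msize n L) j / qpoch q q j * G j)"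
    unfolding h sum_distrib_left[symmetric] sum_milne_term_box[OF q_generic_shift[OF gen]] ..
  also have "\<dots> = (if m = K then qpoch q (\<alpha> * q) (msize n K) / q ^ msize n K else 0)"
  proof (cases "m = K")
    case True
    then have [simp]: "msize n L = 0" "M = msize n K" using sK by (auto simp: M_def)
    let ?N = "msize n K"
    \<comment> \<open>Only \<open>l = 0\<close> is left, and both Milne terms in \<open>C\<close>
      are now top terms equal to \<open>R\<close>. The factor \<open>1 - A\<close> from
      \<open>G 0\<close> extends \<open>qpoch q \<alpha> (2 * ?N)\<close> by one step, so that
      \<open>1 - \<alpha>\<close> can be split off in front.\<close>
    define R where "R = qpoch q (1 / q ^ ?N) ?N / qpoch q q ?N"
    have "R\<^sup>2 * q ^ (?N * ?N + ?N) = 1"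
      unfolding R_def using g(1,2) by (rule qpoch_inverse_power_quot_sq)
    then have R: "R * R * q ^ (?N * ?N) = 1 / q ^ ?N"
      using g(1) by (simp add: power_add power2_eq_square field_simps)
    have "qpoch q \<alpha> (2 * ?N) * (1 - A) = qpoch q \<alpha> (Suc (2 * ?N))"
      by (simp add: qpoch_Suc A_def)
    also have "\<dots> = (1 - \<alpha>) * qpoch q (\<alpha> * q) (2 * ?N)"
      using qpoch_add[of q \<alpha> 1 "2 * ?N"] by (simp add: qpoch_Suc[of _ _ 0, simplified])
    also have "qpoch q (\<alpha> * q) (2 * ?N) = qpoch q (\<alpha> * q) ?N * qpoch q (\<alpha> * q ^ Suc ?N) ?N"
      unfolding mult_2 using qpoch_add[of q "\<alpha> * q" ?N ?N] by (simp add: mult_ac)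
    finally have *: "qpoch q \<alpha> (2 * ?N) * (1 - A) / ((1 - \<alpha>) * qpoch q (\<alpha> * q ^ Suc ?N) ?N) = qpoch q (\<alpha> * q) ?N"
      using \<alpha> by (simp add: field_simps)
    have "C * G 0 = R * R * q ^ (?N * ?N) * (qpoch q \<alpha> (2 * ?N) * (1 - A) / ((1 - \<alpha>) * qpoch q (\<alpha> * q ^ Suc ?N) ?N))"
      unfolding C_def G_def True milne_term_top[OF gen K] R_def[symmetric] by (simp add: mult_ac)
    then show ?thesis unfolding * R using True by simp
  next
    case False
    have "msize n L > 0"
      using False multi_indices_le_eqI[OF m K] sK by (auto simp: M_def)
    moreover have "qpoch q (A * q ^ Suc (msize n L)) j \<noteq> 0" for j
    proof -
      have "qpoch q (\<alpha> * q ^ Suc (msize n K)) (M + j) \<noteq> 0" by (rule \<alpha>)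
      then have "qpoch q (\<alpha> * q ^ Suc (msize n K) * q ^ M) j \<noteq> 0" by (simp add: qpoch_add)
      also have "\<alpha> * q ^ Suc (msize n K) * q ^ M = A * q ^ Suc (msize n L)"
        unfolding A_def sK mult_2 by (simp add: power_add mult_ac)
      finally show ?thesis .
    qed
    ultimately have "(\<Sum>j\<le>msize n L. qpoch q (1 / q ^ msize n L) j / qpoch q q j * G j) = 0"
      using vwp_sum_eq_0[of "msize n L" q A] g(1,2) by (simp add: G_def mult_ac)
    then show ?thesis using False by simp
  qed
  finally show ?thesis .
qed

subsection \<open>Terminating case\<close>

lemma convergent_prod_qpoch_inf:
  fixes q z :: complex
  assumes "norm q < 1"
  shows "convergent_prod (\<lambda>i. 1 - z * q ^ i)"
proof -
  have "summable (\<lambda>i. norm z * norm q ^ i)"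
    using assms by (intro summable_mult summable_geometric) auto
  moreover have "norm (1 - z * q ^ i - 1) = norm z * norm q ^ i" for i
    by (simp add: norm_mult norm_power)
  ultimately have "summable (\<lambda>i. norm (1 - z * q ^ i - 1))"
    by (simp only:)
  then show ?thesis
    by (intro abs_convergent_prod_imp_convergent_prod summable_imp_abs_convergent_prod)
qed

lemma qpoch_tendsto_qpoch_inf:
  assumes "norm q < 1"
  shows "qpoch q z \<longlonglongrightarrow> qpoch_inf q z"
proof -
  have "(\<lambda>n. qpoch q z (Suc n)) \<longlonglongrightarrow> qpoch_inf q z"
    using convergent_prod_LIMSEQ[OF convergent_prod_qpoch_inf[OF assms, of z]]
    by (simp add: qpoch_def qpoch_inf_def lessThan_Suc_atMost)
  then show ?thesis by (rule LIMSEQ_imp_Suc)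
qed

lemma qpoch_inf_split:
  assumes "norm q < 1"
  shows "qpoch_inf q z = qpoch q z k * qpoch_inf q (z * q ^ k)"
proof (rule LIMSEQ_unique)
  show "(\<lambda>j. qpoch q z (k + j)) \<longlonglongrightarrow> qpoch q z k * qpoch_inf q (z * q ^ k)"
    unfolding qpoch_add by (intro tendsto_intros qpoch_tendsto_qpoch_inf assms)
  show "(\<lambda>j. qpoch q z (k + j)) \<longlonglongrightarrow> qpoch_inf q z"
    using LIMSEQ_ignore_initial_segment[OF qpoch_tendsto_qpoch_inf[OF assms, of z], of k]
    by (simp add: add.commute)
qed

lemma qpoch_factor_nonzero:
  fixes q z :: complex
  assumes "norm q < 1" "norm z < 1"
  shows "1 - z * q ^ i \<noteq> 0"
proof -
  have "norm (z * q ^ i) \<le> norm z"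
    using assms(1) by (simp add: norm_mult norm_power mult_left_le power_le_one)
  with assms(2) show ?thesis by auto
qed

section \<open>Rewriting the summands of the series in terms of Milne terms\<close>

lemma power_int_diff_of_nat:
  fixes q :: complex
  assumes "q \<noteq> 0"
  shows "q powi (int i - int j) = q ^ i / q ^ j"
  using assms by (simp add: power_int_diff)

text \<open>Multiplying the factor of the pair \<open>(r, s)\<close> by \<open>q ^ k s\<close>
  clears its negative power of \<open>q\<close>; over all pairs these multipliers form exactly the
  power in the series.\<close>

lemma vandermonde_quot_eq:
  assumes gen: "q_generic q n x"
  shows "vandermonde_quot q n x k * q ^ (\<Sum>r=1..n. (r - 1) * k r) = vandermonde_ratio q n x k"
proof -
  have "q ^ (\<Sum>r=1..n. (r - 1) * k r) = (\<Prod>s=1..n. (q ^ k s) ^ (s - 1))"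
    by (simp add: power_sum power_mult[symmetric] mult.commute)
  also have "\<dots> = (\<Prod>(r, s)\<in>ordered_pairs n. q ^ k s)"
    by (rule prod_ordered_pairs_by_snd[symmetric])
  finally have *: "q ^ (\<Sum>r=1..n. (r - 1) * k r) = (\<Prod>(r, s)\<in>ordered_pairs n. q ^ k s)" .
  show ?thesis
    unfolding * unfolding vandermonde_quot_def vandermonde_ratio_def ordered_pairs_def[symmetric] prod.distrib[symmetric]
  proof (rule prod.cong[OF refl], clarify)
    fix r s assume "(r, s) \<in> ordered_pairs n"
    then have rs: "r \<in> {1..n}" "s \<in> {1..n}" "r \<noteq> s" by (auto simp: ordered_pairs_def)
    then have ne: "x s \<noteq> 0" "x r \<noteq> x s" using q_genericD(3,5)[OF gen] by auto
    have q: "q \<noteq> 0" by (rule q_genericD(1)[OF gen])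
    then have "q powi (int (k r) - int (k s)) = q ^ k r / q ^ k s"
      by (rule power_int_diff_of_nat)
    then show "(1 - q powi (int (k r) - int (k s)) * (x r / x s)) / (1 - x r / x s) * q ^ k s
      = (x s * q ^ k s - x r * q ^ k r) / (x s - x r)"
      using ne q by (simp add: divide_simps) (simp add: algebra_simps)
  qed
qed

text \<open>Of the exponent \<open>r * m r\<close>, the part \<open>(r - 1) * m r\<close> is
  absorbed by \<open>vandermonde_ratio\<close> and \<open>m r\<close> remains. The last parenthesis
  is independent of \<open>k\<close>, which prepares the exchange of the sums.\<close>

lemma inner_sum_eq:
  assumes gen: "q_generic q n x"
  shows "inner_sum q n f \<alpha> b x k = (\<Sum>m\<in>multi_indices_le n k.
     milne_term q n x (\<lambda>s. 1 / q ^ k s) m * qpoch q (\<alpha> * q ^ msize n k) (msize n m) *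
     (q ^ msize n m * f (\<alpha> * q ^ (1 + msize n m)) / (\<Prod>r=1..n. qpoch q (\<alpha> * b * x r) (m r))))"
  unfolding inner_sum_def
proof (rule sum.cong[OF refl])
  fix m
  have "(\<Sum>r=1..n. r * m r) = (\<Sum>r=1..n. (r - 1) * m r + m r)"
    by (intro sum.cong) (auto simp: algebra_simps)
  then have "q ^ (\<Sum>r=1..n. r * m r) = q ^ (\<Sum>r=1..n. (r - 1) * m r) * q ^ msize n m"
    by (simp add: sum.distrib msize_def power_add)
  then show "vandermonde_quot q n x m *
        (\<Prod>r=1..n. \<Prod>s=1..n.
           qpoch q (q powi (- int (k s)) * (x r / x s)) (m r) / qpoch q (q * x r / x s) (m r)) *
        (qpoch q (\<alpha> * q ^ msize n k) (msize n m) / (\<Prod>r=1..n. qpoch q (\<alpha> * b * x r) (m r))) *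
        q ^ (\<Sum>r=1..n. r * m r) *
        f (\<alpha> * q ^ (1 + msize n m)) =
     milne_term q n x (\<lambda>s. 1 / q ^ k s) m * qpoch q (\<alpha> * q ^ msize n k) (msize n m) *
     (q ^ msize n m * f (\<alpha> * q ^ (1 + msize n m)) / (\<Prod>r=1..n. qpoch q (\<alpha> * b * x r) (m r)))"
    unfolding milne_term_def vandermonde_quot_eq[OF gen, symmetric]
    by (simp add: power_int_minus inverse_eq_divide mult_ac)
qed

lemma prod_geometric_shift:
  fixes q \<alpha> :: complex
  assumes "q \<noteq> 0" "\<And>r. r \<in> {1..n} \<Longrightarrow> a r = q ^ Suc (K r)"
  shows "(\<Prod>r=1..n. a r) = q ^ (msize n K + n)"
    and "\<alpha> * (\<Prod>r=1..n. a r) * q powi (1 - int n) = \<alpha> * q ^ Suc (msize n K)"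
proof -
  have "(\<Prod>r=1..n. a r) = (\<Prod>r=1..n. q ^ Suc (K r))"
    using assms(2) by (intro prod.cong) auto
  also have "\<dots> = q ^ (\<Sum>r=1..n. Suc (K r))" by (simp only: power_sum)
  also have "(\<Sum>r=1..n. Suc (K r)) = msize n K + n" by (simp add: msize_def sum_Suc)
  finally show 1: "(\<Prod>r=1..n. a r) = q ^ (msize n K + n)" .
  have "q ^ (msize n K + n) * q powi (1 - int n) = q ^ Suc (msize n K)"
    using power_int_diff_of_nat[OF assms(1), of 1 n] assms(1) by (simp add: power_add)
  then show "\<alpha> * (\<Prod>r=1..n. a r) * q powi (1 - int n) = \<alpha> * q ^ Suc (msize n K)"
    unfolding 1 by (simp only: mult.assoc)
qed

text \<open>With \<open>a s = q ^ Suc (K s)\<close> the extra \<open>q\<close> in the numerators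
  cancels and leaves \<open>1 / q ^ K s\<close>. The product of the \<open>a r\<close> is
  \<open>q ^ (msize n K + n)\<close>, whose part \<open>q ^ n\<close> compensates the factor with
  exponent \<open>- n * msize n k\<close>.\<close>

lemma outer_term_eq:
  assumes gen: "q_generic q n x" and a: "\<forall>r\<in>{1..n}. a r = q ^ Suc (K r)"
  shows "outer_term q n f \<alpha> b x a k =
     milne_term q n x (\<lambda>s. 1 / q ^ K s) k * q ^ (msize n K * msize n k) *
     ((1 - \<alpha> * q ^ (2 * msize n k)) * qpoch q \<alpha> (msize n k) /
        ((1 - \<alpha>) * qpoch q (\<alpha> * q ^ Suc (msize n K)) (msize n k))) * inner_sum q n f \<alpha> b x k"
proof -
  note g = q_genericD[OF gen]
  have "numer q n x k a = numer_raw q n x k a"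
    using a g(1) unfolding numer_def by (intro if_P) auto
  also have "\<dots> = (\<Prod>r=1..n. \<Prod>s=1..n. qpoch q (1 / q ^ K s * x r / x s) (k r)) * q ^ ((msize n K + n) * msize n k)"
  proof -
    have "qpoch q (q * x r / (x s * a s)) (k r) = qpoch q (1 / q ^ K s * x r / x s) (k r)"
      if "s \<in> {1..n}" for r s
      using bspec[OF a that] g(1) by (simp add: mult_ac)
    moreover have "(\<Prod>r=1..n. a r) = q ^ (msize n K + n)"
      by (rule prod_geometric_shift(1)[OF g(1) bspec[OF a]])
    ultimately show ?thesis
      unfolding numer_raw_def power_mult by simp
  qed
  finally have N: "numer q n x k a = \<dots>" .
  have A: "\<alpha> * (\<Prod>r=1..n. a r) * q powi (1 - int n) = \<alpha> * q ^ Suc (msize n K)"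
    by (rule prod_geometric_shift(2)[OF g(1) bspec[OF a]])
  have "(\<Sum>r=1..n. (int r - 1) * int (k r)) = int (\<Sum>r=1..n. (r - 1) * k r)"
    unfolding of_nat_sum by (intro sum.cong) (auto simp: of_nat_diff)
  then have P: "q powi ((\<Sum>r=1..n. (int r - 1) * int (k r)) - int n * int (msize n k))
     = q ^ (\<Sum>r=1..n. (r - 1) * k r) / q ^ (n * msize n k)"
    by (simp only: of_nat_mult[symmetric] power_int_diff_of_nat[OF g(1)])
  have "q ^ ((msize n K + n) * msize n k) = q ^ (msize n K * msize n k) * q ^ (n * msize n k)"
    by (simp add: power_add distrib_right)
  then show ?thesis
    unfolding outer_term_def N P A milne_term_def vandermonde_quot_eq[OF gen, symmetric]
      prod_dividef
    using g(1) by (simp add: mult_ac)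
qed

text \<open>A coincidence \<open>x r * q ^ i = x s * q ^ j\<close> with \<open>i < j\<close> would
  be a zero of \<open>qpoch q (q * x s / x r) (j - i)\<close>; one with \<open>i = j\<close> would
  make a Vandermonde denominator vanish.\<close>

lemma q_generic_if_no_denominator_vanishes:
  assumes "0 < norm q" "norm q < 1" and nd: "no_denominator_vanishes q n \<alpha> b x a"
  shows "q_generic q n x"
  unfolding q_generic_def
proof (intro conjI ballI allI impI)
  show "q \<noteq> 0" using assms(1) by auto
  show "q ^ j \<noteq> 1" if "j > 0" for j
  proof
    assume "q ^ j = 1"
    then have "norm q ^ j = 1" by (metis norm_one norm_power)
    moreover have "norm q ^ j < 1" using assms power_strict_decreasing[OF that, of "norm q"] by simp
    ultimately show False by simp
  qed
  show x: "x r \<noteq> 0" if "r \<in> {1..n}" for r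
    using nd that by (auto simp: no_denominator_vanishes_def)
  have ratio: "1 - x r / x s \<noteq> 0" if "r \<in> {1..n}" "s \<in> {1..n}" "r < s" for r s
    using nd that unfolding no_denominator_vanishes_def by blast
  have less: "x r * q ^ i \<noteq> x s * q ^ j" if "r \<in> {1..n}" "s \<in> {1..n}" "i < j" for r s i j
  proof
    assume "x r * q ^ i = x s * q ^ j"
    also have "q ^ j = q ^ i * q ^ (j - i)" using that(3) by (simp add: power_add[symmetric])
    finally have "x r = x s * q ^ (j - i)" using assms(1) by simp
    then have "q * x s / x r * q ^ (j - i - 1) = 1"
      using x[OF that(1)] that(3) by (simp add: power_eq_if)
    moreover have "qpoch q (q * x s / x r) (j - i) \<noteq> 0"
      using nd that by (auto simp: no_denominator_vanishes_def)
    ultimately show False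
      using that(3) by (auto simp: qpoch_eq_0_iff)
  qed
  fix r s i j :: nat assume rs: "r \<in> {1..n}" "s \<in> {1..n}" "r \<noteq> s"
  consider "i < j" | "j < i" | "i = j" by linarith
  then show "x r * q ^ i \<noteq> x s * q ^ j"
  proof cases
    case 3
    have "x r \<noteq> x s"
    proof (cases "r < s")
      case True
      then show ?thesis using ratio[OF rs(1,2)] x[OF rs(2)] by auto
    next
      case False
      then show ?thesis using ratio[OF rs(2,1)] x[OF rs(2)] rs(3) by auto
    qed
    then show ?thesis using 3 assms(1) by simp
  qed (use less rs in metis)+
qed

lemma has_sum_terminating:
  assumes q: "0 < norm q" "norm q < 1" and nd: "no_denominator_vanishes q n \<alpha> b x a"
    and N: "\<And>r. r \<in> {1..n} \<Longrightarrow> N r \<ge> 1 \<and> a r = q ^ N r"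
  shows "((\<lambda>k. outer_term q n f \<alpha> b x a k) has_sum lhs q n f \<alpha> b x a) (multi_indices n)"
proof -
  have gen: "q_generic q n x" by (rule q_generic_if_no_denominator_vanishes[OF q nd])
  note g = q_genericD[OF gen]
  define K where "K = (\<lambda>r\<in>{1..n}. N r - 1)"
  have K: "K \<in> multi_indices n" by (auto simp: K_def multi_indices_def)
  have a: "a r = q ^ Suc (K r)" if "r \<in> {1..n}" for r
    using N[OF that] that by (simp add: K_def del: power_Suc)
  then have a_all: "\<forall>r\<in>{1..n}. a r = q ^ Suc (K r)" by blast
  let ?S = "msize n K"
  have A: "\<alpha> * (\<Prod>r=1..n. a r) * q powi (1 - int n) = \<alpha> * q ^ Suc ?S"
    by (rule prod_geometric_shift(2)[OF g(1) a])
  have \<alpha>: "\<alpha> \<noteq> 1" "\<And>j. qpoch q (\<alpha> * q ^ Suc ?S) j \<noteq> 0" "qpoch_inf q (\<alpha> * q ^ Suc ?S) \<noteq> 0"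
    and bx: "\<And>r. r \<in> {1..n} \<Longrightarrow> qpoch_inf q (\<alpha> * b * x r) \<noteq> 0"
    using nd unfolding no_denominator_vanishes_def A by auto
  define h where "h k m = milne_term q n x (\<lambda>s. 1 / q ^ K s) k * milne_term q n x (\<lambda>s. 1 / q ^ k s) m *
      q ^ (?S * msize n k) *
      ((1 - \<alpha> * q ^ (2 * msize n k)) * qpoch q \<alpha> (msize n k) /
        ((1 - \<alpha>) * qpoch q (\<alpha> * q ^ Suc ?S) (msize n k))) *
      qpoch q (\<alpha> * q ^ msize n k) (msize n m)" for k m
  \<comment> \<open>\<open>\<phi>\<close> holds the part of the summand that depends on
    \<open>m\<close> only, including \<open>f\<close>; thus \<open>f\<close> is never evaluated
    inside the inversion.\<close>
  define \<phi> where "\<phi> m = q ^ msize n m * f (\<alpha> * q ^ (1 + msize n m)) / (\<Prod>r=1..n. qpoch q (\<alpha> * b * x r) (m r))" for m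
  have term_eq: "outer_term q n f \<alpha> b x a k = (\<Sum>m\<in>multi_indices_le n k. h k m * \<phi> m)" for k
    unfolding outer_term_eq[OF gen a_all] inner_sum_eq[OF gen] \<phi>_def[symmetric] sum_distrib_left h_def
    by (simp add: mult_ac)
  have "(\<Sum>k\<in>multi_indices_le n K. outer_term q n f \<alpha> b x a k)
     = (\<Sum>k\<in>multi_indices_le n K. \<Sum>m | m \<in> multi_indices_le n K \<and> (\<forall>r\<in>{1..n}. m r \<le> k r). h k m * \<phi> m)"
    unfolding term_eq
  proof (rule sum.cong[OF refl], rule sum.cong)
    fix k assume k: "k \<in> multi_indices_le n K"
    show "multi_indices_le n k = {m. m \<in> multi_indices_le n K \<and> (\<forall>r\<in>{1..n}. m r \<le> k r)}"
      using k by (fastforce simp: multi_indices_le_def PiE_iff)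
  qed simp
  \<comment> \<open>The region \<open>m \<le> k \<le> K\<close> is summed in the other order, so
    that the inner sum over \<open>k\<close> is the one in \<open>bailey_inversion\<close>.\<close>
  also have "\<dots> = (\<Sum>m\<in>multi_indices_le n K. \<Sum>k | k \<in> multi_indices_le n K \<and> (\<forall>r\<in>{1..n}. m r \<le> k r). h k m * \<phi> m)"
    using sum.swap_restrict[of "multi_indices_le n K" "multi_indices_le n K" "\<lambda>k m. h k m * \<phi> m"
        "\<lambda>k m. \<forall>r\<in>{1..n}. m r \<le> k r"] by simp
  also have "\<dots> = (\<Sum>m\<in>multi_indices_le n K. if m = K then qpoch q (\<alpha> * q) ?S / q ^ ?S * \<phi> m else 0)"
    unfolding sum_distrib_right[symmetric] h_def
    using bailey_inversion[OF gen K _ \<alpha>(1,2)] by (intro sum.cong) auto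
  also have "\<dots> = qpoch q (\<alpha> * q) ?S / q ^ ?S * \<phi> K"
    using K by (subst sum.delta) (simp, auto simp: multi_indices_le_def multi_indices_def PiE_iff)
  also have "\<dots> = lhs q n f \<alpha> b x a"
  proof -
    \<comment> \<open>In each quotient of infinite products a common tail cancels and a finite
      factorial remains; the power of \<open>q\<close> in \<open>\<phi> K\<close> cancels the one
      from the inversion.\<close>
    have "qpoch_inf q (\<alpha> * q) / qpoch_inf q (\<alpha> * q ^ Suc ?S) = qpoch q (\<alpha> * q) ?S"
      using qpoch_inf_split[OF q(2), of "\<alpha> * q" ?S] \<alpha>(3) by (simp add: mult_ac)
    moreover have "qpoch_inf q (\<alpha> * a r * b * x r / q) / qpoch_inf q (\<alpha> * b * x r) = 1 / qpoch q (\<alpha> * b * x r) (K r)"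
      if "r \<in> {1..n}" for r
    proof -
      have "\<alpha> * a r * b * x r / q = \<alpha> * b * x r * q ^ K r"
        using a[OF that] g(1) by simp
      then show ?thesis
        using qpoch_inf_split[OF q(2), of "\<alpha> * b * x r" "K r"] bx[OF that] by auto
    qed
    ultimately show ?thesis
      unfolding lhs_def A \<phi>_def using g(1) by (simp add: prod_dividef)
  qed
  finally have sum: "lhs q n f \<alpha> b x a = (\<Sum>k\<in>multi_indices_le n K. outer_term q n f \<alpha> b x a k)" ..
  show ?thesis
  proof (rule has_sum_finite_neutralI[OF _ _ _ sum])
    show "multi_indices_le n K \<subseteq> multi_indices n"
      by (auto simp: multi_indices_le_def multi_indices_def PiE_iff)
    fix k assume "k \<in> multi_indices n - multi_indices_le n K"
    then obtain r where "r \<in> {1..n}" "K r < k r"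
      by (auto simp: multi_indices_def multi_indices_le_def PiE_iff not_le)
    then show "outer_term q n f \<alpha> b x a k = 0"
      unfolding outer_term_eq[OF gen a_all] using milne_term_eq_0[OF gen] by simp
  qed simp
qed

subsection \<open>Analytic continuation\<close>

text \<open>On a line in direction \<open>p\<close> through the centre of the local expansion, every
  monomial involving another variable vanishes, and a one-variable power series remains.\<close>

lemma holomorphic_on_coordinate:
  assumes F: "multi_analytic_on n F (polydisc n \<rho>)" and c: "c \<in> polydisc n \<rho>" and p: "p \<in> {1..n}"
  shows "(\<lambda>t. F (c(p := t))) holomorphic_on ball 0 (\<rho> p)"
  unfolding holomorphic_on_open[OF open_ball]
proof
  fix t0 :: complex assume t0: "t0 \<in> ball 0 (\<rho> p)"
  let ?c = "c(p := t0)"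
  have "?c \<in> polydisc n \<rho>" using c t0 by (auto simp: polydisc_def)
  then obtain C \<epsilon> where \<epsilon>: "\<epsilon> > 0" and
    C: "\<And>a. (\<forall>r\<in>{1..n}. norm (a r - ?c r) < \<epsilon>) \<Longrightarrow>
        ((\<lambda>j. C j * (\<Prod>r=1..n. (a r - ?c r) ^ j r)) has_sum F a) (multi_indices n)"
    using F unfolding multi_analytic_on_def by meson
  \<comment> \<open>\<open>e i\<close> is \<open>i\<close> times the \<open>p\<close>-th unit
    multi-index; these are the only indices that survive.\<close>
  define e where "e i = (\<lambda>r\<in>{1..n}. if r = p then i else 0)" for i :: nat
  have "(\<lambda>i. C (e i) * (t - t0) ^ i) sums F (c(p := t))" if t: "t \<in> ball t0 \<epsilon>" for t
  proof -
    \<comment> \<open>Since \<open>0 ^ 0 = 1\<close>, the product of the \<open>0 ^ j r\<close> is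
      the indicator of the multi-indices supported at \<open>p\<close>.\<close>
    have *: "(\<Prod>r=1..n. ((c(p := t)) r - ?c r) ^ j r) = (t - t0) ^ j p * (\<Prod>r\<in>{1..n} - {p}. 0 ^ j r)" for j
      using p by (subst prod.remove[of _ p]) (auto intro!: prod.cong)
    have "((\<lambda>j. C j * ((t - t0) ^ j p * (\<Prod>r\<in>{1..n} - {p}. 0 ^ j r))) has_sum F (c(p := t))) (multi_indices n)"
      unfolding *[symmetric] using t \<epsilon> by (intro C) (auto simp: dist_norm norm_minus_commute)
    also have "?this \<longleftrightarrow> ((\<lambda>j. C j * (t - t0) ^ j p) has_sum F (c(p := t))) (range e)"
    proof (rule has_sum_cong_neutral)
      fix j assume j: "j \<in> multi_indices n - range e"
      have "\<exists>r\<in>{1..n} - {p}. j r \<noteq> 0"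
      proof (rule ccontr)
        assume "\<not> (\<exists>r\<in>{1..n} - {p}. j r \<noteq> 0)"
        then have "j = e (j p)"
          using j by (auto simp: e_def multi_indices_def PiE_iff extensional_def fun_eq_iff)
        with j show False by blast
      qed
      then have "(\<Prod>r\<in>{1..n} - {p}. (0::complex) ^ j r) = 0" by (intro prod_zero) auto
      then show "C j * ((t - t0) ^ j p * (\<Prod>r\<in>{1..n} - {p}. 0 ^ j r)) = 0" by simp
    next
      fix j assume "j \<in> range e - multi_indices n"
      then show "C j * (t - t0) ^ j p = 0" by (auto simp: e_def multi_indices_def)
    next
      fix j assume "j \<in> multi_indices n \<inter> range e"
      then have "(\<Prod>r\<in>{1..n} - {p}. (0::complex) ^ j r) = 1"
        by (intro prod.neutral) (auto simp: e_def split: if_splits)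
      then show "C j * ((t - t0) ^ j p * (\<Prod>r\<in>{1..n} - {p}. 0 ^ j r)) = C j * (t - t0) ^ j p" by simp
    qed
    also have "\<dots> \<longleftrightarrow> (((\<lambda>j. C j * (t - t0) ^ j p) \<circ> e) has_sum F (c(p := t))) UNIV"
    proof (rule has_sum_reindex, rule injI)
      show "i = j" if "e i = e j" for i j using fun_cong[OF that, of p] p by (simp add: e_def)
    qed
    finally show ?thesis using p by (intro has_sum_imp_sums) (simp add: o_def e_def)
  qed
  then have "(\<lambda>t. F (c(p := t))) holomorphic_on ball t0 \<epsilon>"
    by (rule power_series_holomorphic)
  then show "\<exists>f'. ((\<lambda>t. F (c(p := t))) has_field_derivative f') (at t0)"
    using \<epsilon> by (auto simp: holomorphic_on_open)
qed

lemma zero_islimpt_powers: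
  fixes q :: complex
  assumes "0 < norm q" "norm q < 1" "\<rho> > 0"
  shows "0 islimpt {t \<in> ball 0 \<rho>. \<exists>N\<ge>M. t = q ^ N}"
  unfolding islimpt_approachable
proof (intro allI impI)
  fix e :: real assume "e > 0"
  have "(\<lambda>N. norm q ^ N) \<longlonglongrightarrow> 0" using assms by (intro LIMSEQ_power_zero) auto
  then have "\<forall>\<^sub>F N in sequentially. norm q ^ N < min e \<rho> \<and> N \<ge> M"
    using \<open>e > 0\<close> assms(3) by (intro eventually_conj order_tendstoD(2) eventually_ge_at_top) auto
  then obtain N where "norm q ^ N < min e \<rho>" "N \<ge> M"
    using eventually_happens'[OF sequentially_bot] by blast
  then show "\<exists>t'\<in>{t \<in> ball 0 \<rho>. \<exists>N\<ge>M. t = q ^ N}. t' \<noteq> 0 \<and> dist t' 0 < e"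
    using assms by (intro bexI[of _ "q ^ N"]) (auto simp: norm_power)
qed

text \<open>Coordinates are freed one at a time: the induction statement for \<open>p\<close> lets
  the first \<open>p\<close> coordinates be arbitrary and keeps the others at powers of
  \<open>q\<close>. The bound \<open>M\<close> leaves room to exclude small exponents.\<close>

lemma multi_analytic_eqI:
  fixes q :: complex
  assumes q: "0 < norm q" "norm q < 1" and \<rho>: "\<And>r. r \<in> {1..n} \<Longrightarrow> \<rho> r > 0"
    and F: "multi_analytic_on n F (polydisc n \<rho>)" and G: "multi_analytic_on n G (polydisc n \<rho>)"
    and eq: "\<And>c. c \<in> polydisc n \<rho> \<Longrightarrow> (\<And>r. r \<in> {1..n} \<Longrightarrow> \<exists>N\<ge>M. c r = q ^ N) \<Longrightarrow> F c = G c"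
    and a: "a \<in> polydisc n \<rho>"
  shows "F a = G a"
proof -
  have "\<forall>c\<in>polydisc n \<rho>. (\<forall>r\<in>{1..n}. r > p \<longrightarrow> (\<exists>N\<ge>M. c r = q ^ N)) \<longrightarrow> F c = G c" if "p \<le> n" for p
    using that
  proof (induction p)
    case 0
    then show ?case using eq by auto
  next
    case (Suc p)
    show ?case
    proof (intro ballI impI)
      fix c assume c: "c \<in> polydisc n \<rho>" and cN: "\<forall>r\<in>{1..n}. r > Suc p \<longrightarrow> (\<exists>N\<ge>M. c r = q ^ N)"
      let ?p = "Suc p"
      have p: "?p \<in> {1..n}" using Suc.prems by simp
      define U where "U = {t \<in> ball 0 (\<rho> ?p). \<exists>N\<ge>M. t = q ^ N}"
      \<comment> \<open>The induction hypothesis gives equality for powers of \<open>q\<close> in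
        this coordinate; they accumulate at 0, inside the disc, so the one-variable identity theorem
        applies.\<close>
      have "F (c(?p := c ?p)) - G (c(?p := c ?p)) = 0"
      proof (rule analytic_continuation[where f = "\<lambda>t. F (c(?p := t)) - G (c(?p := t))" and w = "c ?p"
            and U = U and \<xi> = 0 and S = "ball 0 (\<rho> ?p)"])
        show "(\<lambda>t. F (c(?p := t)) - G (c(?p := t))) holomorphic_on ball 0 (\<rho> ?p)"
          by (intro holomorphic_on_diff holomorphic_on_coordinate[OF F c p] holomorphic_on_coordinate[OF G c p])
        show "0 islimpt U"
          unfolding U_def by (rule zero_islimpt_powers[OF q \<rho>[OF p]])
        show "F (c(?p := t)) - G (c(?p := t)) = 0" if "t \<in> U" for t
        proof -
          have "c(?p := t) \<in> polydisc n \<rho>" using c that by (auto simp: polydisc_def U_def)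
          moreover have "\<exists>N\<ge>M. (c(?p := t)) r = q ^ N" if "r \<in> {1..n}" "r > p" for r
            using that cN \<open>t \<in> U\<close> by (cases "r = ?p") (auto simp: U_def)
          ultimately show ?thesis using Suc by auto
        qed
        show "c ?p \<in> ball 0 (\<rho> ?p)" using c p by (auto simp: polydisc_def)
      qed (use \<rho>[OF p] in \<open>auto simp: U_def\<close>)
      then show "F c = G c" by simp
    qed
  qed
  from this[of n] show ?thesis using a by auto
qed

theorem theorem1p5:
  fixes q \<alpha> b :: complex and n :: nat
    and x a :: "nat \<Rightarrow> complex" and f :: "complex \<Rightarrow> complex"
  assumes "0 < norm q" and "norm q < 1" and "n \<ge> 1"
    and "no_denominator_vanishes q n \<alpha> b x a"
    and "(\<exists>\<rho>. (\<forall>r\<in>{1..n}. \<rho> r > 0) \<and>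
            multi_analytic_on n (\<lambda>c. lhs q n f \<alpha> b x c) (polydisc n \<rho>) \<and>
            multi_analytic_on n (\<lambda>c. rhs q n f \<alpha> b x c) (polydisc n \<rho>) \<and>
            (\<forall>c\<in>polydisc n \<rho>. (\<lambda>k. norm (outer_term q n f \<alpha> b x c k)) summable_on multi_indices n) \<and>
            a \<in> polydisc n \<rho>)
         \<or> (\<exists>N :: nat \<Rightarrow> nat. \<forall>r\<in>{1..n}. N r \<ge> 1 \<and> a r = q ^ N r)"
  shows "((\<lambda>k. outer_term q n f \<alpha> b x a k) has_sum lhs q n f \<alpha> b x a) (multi_indices n)"
  using assms(5)
proof (elim disjE exE conjE)
  fix N :: "nat \<Rightarrow> nat"
  assume "\<forall>r\<in>{1..n}. N r \<ge> 1 \<and> a r = q ^ N r"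
  then show ?thesis by (intro has_sum_terminating[OF assms(1,2,4)]) blast
next
  fix \<rho> :: "nat \<Rightarrow> real"
  assume \<rho>: "\<forall>r\<in>{1..n}. \<rho> r > 0"
    and L: "multi_analytic_on n (\<lambda>c. lhs q n f \<alpha> b x c) (polydisc n \<rho>)"
    and R: "multi_analytic_on n (\<lambda>c. rhs q n f \<alpha> b x c) (polydisc n \<rho>)"
    and S: "\<forall>c\<in>polydisc n \<rho>. (\<lambda>k. norm (outer_term q n f \<alpha> b x c k)) summable_on multi_indices n"
    and a: "a \<in> polydisc n \<rho>"
  have q0: "q \<noteq> 0" using assms(1) by auto
  \<comment> \<open>The nonvanishing hypothesis concerns \<open>a\<close>, not the interpolation
    points. For large exponents the base \<open>\<alpha> * q ^ Suc (msize n K)\<close> there has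
    norm below 1, so its factorials have no zero factor.\<close>
  have "(\<lambda>M. norm \<alpha> * norm q ^ M) \<longlonglongrightarrow> norm \<alpha> * 0"
    using assms(2) by (intro tendsto_intros LIMSEQ_power_zero) auto
  then have "\<forall>\<^sub>F M in sequentially. norm \<alpha> * norm q ^ M < 1"
    by (intro order_tendstoD(2)) auto
  then obtain M where M: "norm \<alpha> * norm q ^ M < 1"
    using eventually_happens'[OF sequentially_bot] by blast
  have "rhs q n f \<alpha> b x a = lhs q n f \<alpha> b x a"
  proof (rule multi_analytic_eqI[OF assms(1,2) _ R L _ a, of "Suc M"])
    fix c assume "c \<in> polydisc n \<rho>" and c: "\<And>r. r \<in> {1..n} \<Longrightarrow> \<exists>N\<ge>Suc M. c r = q ^ N"
    then obtain N where N: "\<And>r. r \<in> {1..n} \<Longrightarrow> N r \<ge> Suc M \<and> c r = q ^ N r" by metis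
    define K where "K r = N r - 1" for r
    have K: "c r = q ^ Suc (K r)" "K r \<ge> M" if "r \<in> {1..n}" for r
      using N[OF that] by (auto simp: K_def simp del: power_Suc)
    have A: "\<alpha> * (\<Prod>r=1..n. c r) * q powi (1 - int n) = \<alpha> * q ^ Suc (msize n K)"
      by (rule prod_geometric_shift(2)[OF q0 K(1)])
    \<comment> \<open>One large coordinate is enough to make the size large;
      \<open>n \<ge> 1\<close> ensures that there is one.\<close>
    have "K 1 \<le> msize n K"
      unfolding msize_def using assms(3) by (intro member_le_sum) auto
    then have "M \<le> Suc (msize n K)" using K(2)[of 1] assms(3) by simp
    then have "norm (\<alpha> * q ^ Suc (msize n K)) \<le> norm \<alpha> * norm q ^ M"
      unfolding norm_mult norm_power using assms(2) by (intro mult_left_mono power_decreasing) auto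
    with M have z: "norm (\<alpha> * q ^ Suc (msize n K)) < 1" by linarith
    have "qpoch_inf q (\<alpha> * q ^ Suc (msize n K)) \<noteq> 0"
      unfolding qpoch_inf_def
      by (intro prodinf_nonzero convergent_prod_qpoch_inf qpoch_factor_nonzero assms(2) z)
    moreover have "qpoch q (\<alpha> * q ^ Suc (msize n K)) k \<noteq> 0" for k
      unfolding qpoch_def using qpoch_factor_nonzero[OF assms(2) z] by simp
    ultimately have "no_denominator_vanishes q n \<alpha> b x c"
      using assms(4) unfolding no_denominator_vanishes_def A by blast
    then have "(outer_term q n f \<alpha> b x c has_sum lhs q n f \<alpha> b x c) (multi_indices n)"
    proof (rule has_sum_terminating[OF assms(1,2)])
      show "N r \<ge> 1 \<and> c r = q ^ N r" if "r \<in> {1..n}" for r using N[OF that] by simp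
    qed
    then show "rhs q n f \<alpha> b x c = lhs q n f \<alpha> b x c"
      unfolding rhs_def by (rule infsumI)
  qed (use \<rho> in auto)
  \<comment> \<open>As \<open>rhs\<close> is an \<open>infsum\<close>, absolute convergence is what
    turns its value into a genuine \<open>has_sum\<close> statement.\<close>
  moreover have "outer_term q n f \<alpha> b x a summable_on multi_indices n"
    by (rule abs_summable_summable) (rule bspec[OF S a])
  then have "(outer_term q n f \<alpha> b x a has_sum rhs q n f \<alpha> b x a) (multi_indices n)"
    unfolding rhs_def by (rule has_sum_infsum)
  ultimately show ?thesis by simp
qed

end
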